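(* Let $K$ be a field. The following two statements are equivalent: (i) every 3-nilpotent Lie algebra over $K$ has a zero reduced Koszul map; (ii) every metabelian Lie algebra over $K$ has a zero reduced Koszul map.
   Context: A Lie algebra $\mathfrak{g}$ is 3-nilpotent if $[\mathfrak{g},[\mathfrak{g},[\mathfrak{g},\mathfrak{g}]]]=\{0\}$, and metabelian if $[\mathfrak{g},\mathfrak{g}]$ is abelian. Lie algebras are not assumed finite-dimensional. Tensor, exterior and symmetric powers are over $K$. $H_*(\mathfrak{g})$ is the homology of the Chevalley–Eilenberg complex $\Lambda^*\mathfrak{g}$ with $\partial_n(x_1\wedge\dots\wedge x_n)=\sum_{i<j}(-1)^{i+j}[x_i,x_j]\wedge x_1\wedge\dots\wedge\hat{x_i}\wedge\dots\wedge\hat{x_j}\wedge\dots\wedge x_n$, and $Z_3(\mathfrak{g})=\ker\partial_3$. Writing $x\odot y$ for the product in the symmetric square $S^2\mathfrak{g}$, the Killing module $\mathrm{Kill}(\mathfrak{g})$ is the cokernel of $\mathfrak{g}^{\otimes 3}\to S^2\mathfrak{g}$, $x\otimes y\otimes z\mapsto [x,y]\odot z-x\odot[y,z]$. The Koszul map $\eta:\Lambda^3\mathfrak{g}\to\mathrm{Kill}(\mathfrak{g})$ sends $x\wedge y\wedge z$ to the class of $x\odot[y,z]$; it vanishes on 3-boundaries, and the reduced Koszul map $\bar\eta:H_3(\mathfrak{g})\to\mathrm{Kill}(\mathfrak{g})$ is induced by restricting $\eta$ to $Z_3(\mathfrak{g})$. *)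

theory Defs
  imports "HOL-Algebra.Module" "HOL-Algebra.AbelCoset"
begin

section \<open>Lie algebras\<close>

text \<open>As for every HOL-Algebra module, the ring multiplication and unit that the record
  \<open>module\<close> inherits from \<open>ring\<close> carry no information.\<close>

record ('k, 'a) lie_structure = "('k, 'a) module" +
  bracket :: "'a \<Rightarrow> 'a \<Rightarrow> 'a"

locale lie_algebra = module K L
  for K :: "('k, 'm) ring_scheme" and L :: "('k, 'a, 'n) lie_structure_scheme" (structure) +
  assumes bracket_closed:
      "\<lbrakk>x \<in> carrier L; y \<in> carrier L\<rbrakk> \<Longrightarrow> bracket L x y \<in> carrier L"
    and bracket_add_left:
      "\<lbrakk>x \<in> carrier L; y \<in> carrier L; z \<in> carrier L\<rbrakk>
        \<Longrightarrow> bracket L (x \<oplus>\<^bsub>L\<^esub> y) z = bracket L x z \<oplus>\<^bsub>L\<^esub> bracket L y z"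
    and bracket_add_right:
      "\<lbrakk>x \<in> carrier L; y \<in> carrier L; z \<in> carrier L\<rbrakk>
        \<Longrightarrow> bracket L x (y \<oplus>\<^bsub>L\<^esub> z) = bracket L x y \<oplus>\<^bsub>L\<^esub> bracket L x z"
    and bracket_smult_left:
      "\<lbrakk>c \<in> carrier K; x \<in> carrier L; y \<in> carrier L\<rbrakk>
        \<Longrightarrow> bracket L (c \<odot>\<^bsub>L\<^esub> x) y = c \<odot>\<^bsub>L\<^esub> bracket L x y"
    and bracket_smult_right:
      "\<lbrakk>c \<in> carrier K; x \<in> carrier L; y \<in> carrier L\<rbrakk>
        \<Longrightarrow> bracket L x (c \<odot>\<^bsub>L\<^esub> y) = c \<odot>\<^bsub>L\<^esub> bracket L x y"
    and bracket_self: "x \<in> carrier L \<Longrightarrow> bracket L x x = \<zero>\<^bsub>L\<^esub>"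
    and jacobi:
      "\<lbrakk>x \<in> carrier L; y \<in> carrier L; z \<in> carrier L\<rbrakk>
        \<Longrightarrow> bracket L x (bracket L y z) \<oplus>\<^bsub>L\<^esub> bracket L y (bracket L z x)
            \<oplus>\<^bsub>L\<^esub> bracket L z (bracket L x y) = \<zero>\<^bsub>L\<^esub>"

definition module_span ::
    "('k, 'm) ring_scheme \<Rightarrow> ('k, 'a, 'n) module_scheme \<Rightarrow> 'a set \<Rightarrow> 'a set" where
  "module_span K M S = \<Inter>{N. submodule N K M \<and> S \<subseteq> N}"

definition lie_commutator ::
    "('k, 'm) ring_scheme \<Rightarrow> ('k, 'a, 'n) lie_structure_scheme \<Rightarrow> 'a set \<Rightarrow> 'a set \<Rightarrow> 'a set" where
  "lie_commutator K L A B = module_span K L {bracket L x y |x y. x \<in> A \<and> y \<in> B}"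

definition three_nilpotent ::
    "('k, 'm) ring_scheme \<Rightarrow> ('k, 'a, 'n) lie_structure_scheme \<Rightarrow> bool" where
  "three_nilpotent K L \<longleftrightarrow>
     lie_commutator K L (carrier L)
       (lie_commutator K L (carrier L)
         (lie_commutator K L (carrier L) (carrier L))) = {\<zero>\<^bsub>L\<^esub>}"

definition metabelian ::
    "('k, 'm) ring_scheme \<Rightarrow> ('k, 'a, 'n) lie_structure_scheme \<Rightarrow> bool" where
  "metabelian K L \<longleftrightarrow>
     (\<forall>x \<in> lie_commutator K L (carrier L) (carrier L).
      \<forall>y \<in> lie_commutator K L (carrier L) (carrier L). bracket L x y = \<zero>\<^bsub>L\<^esub>)"


section \<open>Quotient modules and modules given by generators and relations\<close>

definition quot_module ::
    "('k, 'a, 'n) module_scheme \<Rightarrow> 'a set \<Rightarrow> ('k, 'a set) module" where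
  "quot_module M N =
     \<lparr>carrier = a_rcosets\<^bsub>M\<^esub> N, mult = undefined, one = undefined,
      zero = N, add = (<+>\<^bsub>M\<^esub>),
      smult = (\<lambda>c A. N <+>\<^bsub>M\<^esub> (\<lambda>a. c \<odot>\<^bsub>M\<^esub> a) ` A)\<rparr>"

definition free_module :: "('k, 'm) ring_scheme \<Rightarrow> 'x set \<Rightarrow> ('k, 'x \<Rightarrow> 'k) module" where
  "free_module K X =
     \<lparr>carrier = {f. (\<forall>x. f x \<in> carrier K) \<and> (\<forall>x. x \<notin> X \<longrightarrow> f x = \<zero>\<^bsub>K\<^esub>)
                    \<and> finite {x. f x \<noteq> \<zero>\<^bsub>K\<^esub>}},
      mult = undefined, one = undefined,
      zero = (\<lambda>_. \<zero>\<^bsub>K\<^esub>), add = (\<lambda>f g x. f x \<oplus>\<^bsub>K\<^esub> g x),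
      smult = (\<lambda>c f x. c \<otimes>\<^bsub>K\<^esub> f x)\<rparr>"

definition free_gen :: "('k, 'm) ring_scheme \<Rightarrow> 'x \<Rightarrow> 'x \<Rightarrow> 'k" where
  "free_gen K x = (\<lambda>y. if y = x then \<one>\<^bsub>K\<^esub> else \<zero>\<^bsub>K\<^esub>)"

definition presented_module ::
    "('k, 'm) ring_scheme \<Rightarrow> 'x set \<Rightarrow> ('x \<Rightarrow> 'k) set \<Rightarrow> ('k, ('x \<Rightarrow> 'k) set) module" where
  "presented_module K X R =
     quot_module (free_module K X) (module_span K (free_module K X) R)"

definition presented_gen ::
    "('k, 'm) ring_scheme \<Rightarrow> 'x set \<Rightarrow> ('x \<Rightarrow> 'k) set \<Rightarrow> 'x \<Rightarrow> ('x \<Rightarrow> 'k) set" where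
  "presented_gen K X R x =
     module_span K (free_module K X) R +>\<^bsub>free_module K X\<^esub> free_gen K x"

text \<open>The linear map into \<open>N\<close>, defined on a module given by generators and relations, that
  takes the value \<open>\<phi> x\<close> on the class of each generator \<open>x\<close>. An element of the source is a
  coset \<open>A\<close> of formal linear combinations. Meaningful only if the linear extension
  of \<open>\<phi>\<close> vanishes on the relations, so that it takes a single value on \<open>A\<close>.\<close>

definition linear_ext ::
    "('k, 'm) ring_scheme \<Rightarrow> ('k, 'b, 'n) module_scheme \<Rightarrow> ('x \<Rightarrow> 'b) \<Rightarrow> ('x \<Rightarrow> 'k) set \<Rightarrow> 'b" where
  "linear_ext K N \<phi> A =
     the_elem ((\<lambda>f. \<Oplus>\<^bsub>N\<^esub>x\<in>{x. f x \<noteq> \<zero>\<^bsub>K\<^esub>}. f x \<odot>\<^bsub>N\<^esub> \<phi> x) ` A)"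


section \<open>Tensor, exterior and symmetric powers\<close>

definition tuples :: "('a, 'n) partial_object_scheme \<Rightarrow> nat \<Rightarrow> 'a list set" where
  "tuples L n = {xs. set xs \<subseteq> carrier L \<and> length xs = n}"

definition multilinear_rels ::
    "('k, 'm) ring_scheme \<Rightarrow> ('k, 'a, 'n) module_scheme \<Rightarrow> nat \<Rightarrow> ('a list \<Rightarrow> 'k) set" where
  "multilinear_rels K L n =
     (let F = free_module K (tuples L n) in
       {free_gen K (xs[i := x \<oplus>\<^bsub>L\<^esub> y])
          \<ominus>\<^bsub>F\<^esub> (free_gen K (xs[i := x]) \<oplus>\<^bsub>F\<^esub> free_gen K (xs[i := y]))
        |xs i x y. xs \<in> tuples L n \<and> i < n \<and> x \<in> carrier L \<and> y \<in> carrier L}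
       \<union> {free_gen K (xs[i := c \<odot>\<^bsub>L\<^esub> x]) \<ominus>\<^bsub>F\<^esub> c \<odot>\<^bsub>F\<^esub> free_gen K (xs[i := x])
        |xs i c x. xs \<in> tuples L n \<and> i < n \<and> c \<in> carrier K \<and> x \<in> carrier L})"

definition tensor_power ::
    "('k, 'm) ring_scheme \<Rightarrow> ('k, 'a, 'n) module_scheme \<Rightarrow> nat \<Rightarrow> ('k, ('a list \<Rightarrow> 'k) set) module" where
  "tensor_power K L n = presented_module K (tuples L n) (multilinear_rels K L n)"

definition exterior_rels ::
    "('k, 'm) ring_scheme \<Rightarrow> ('k, 'a, 'n) module_scheme \<Rightarrow> nat \<Rightarrow> ('a list \<Rightarrow> 'k) set" where
  "exterior_rels K L n =
     multilinear_rels K L n \<union> {free_gen K xs |xs. xs \<in> tuples L n \<and> \<not> distinct xs}"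

definition exterior_power ::
    "('k, 'm) ring_scheme \<Rightarrow> ('k, 'a, 'n) module_scheme \<Rightarrow> nat \<Rightarrow> ('k, ('a list \<Rightarrow> 'k) set) module" where
  "exterior_power K L n = presented_module K (tuples L n) (exterior_rels K L n)"

definition wedge ::
    "('k, 'm) ring_scheme \<Rightarrow> ('k, 'a, 'n) module_scheme \<Rightarrow> 'a list \<Rightarrow> ('a list \<Rightarrow> 'k) set" where
  "wedge K L xs =
     presented_gen K (tuples L (length xs)) (exterior_rels K L (length xs)) xs"

definition sym_square_rels ::
    "('k, 'm) ring_scheme \<Rightarrow> ('k, 'a, 'n) module_scheme \<Rightarrow> ('a list \<Rightarrow> 'k) set" where
  "sym_square_rels K L =
     multilinear_rels K L 2
     \<union> {free_gen K [x, y] \<ominus>\<^bsub>free_module K (tuples L 2)\<^esub> free_gen K [y, x]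
        |x y. x \<in> carrier L \<and> y \<in> carrier L}"

definition sym_square ::
    "('k, 'm) ring_scheme \<Rightarrow> ('k, 'a, 'n) module_scheme \<Rightarrow> ('k, ('a list \<Rightarrow> 'k) set) module" where
  "sym_square K L = presented_module K (tuples L 2) (sym_square_rels K L)"

definition sym_prod ::
    "('k, 'm) ring_scheme \<Rightarrow> ('k, 'a, 'n) module_scheme \<Rightarrow> 'a \<Rightarrow> 'a \<Rightarrow> ('a list \<Rightarrow> 'k) set" where
  "sym_prod K L x y = presented_gen K (tuples L 2) (sym_square_rels K L) [x, y]"


section \<open>Chevalley--Eilenberg homology\<close>

text \<open>List positions start at 0 instead of 1; this leaves the parity of \<open>i + j\<close> unchanged.
  The list \<open>nths xs (- {i, j})\<close> is \<open>xs\<close> with its entries at positions \<open>i\<close> and \<open>j\<close> deleted.\<close>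

definition ce_boundary ::
    "('k, 'm) ring_scheme \<Rightarrow> ('k, 'a, 'n) lie_structure_scheme \<Rightarrow> nat
      \<Rightarrow> ('a list \<Rightarrow> 'k) set \<Rightarrow> ('a list \<Rightarrow> 'k) set" where
  "ce_boundary K L n =
     linear_ext K (exterior_power K L (n - 1))
       (\<lambda>xs. \<Oplus>\<^bsub>exterior_power K L (n - 1)\<^esub>p\<in>{(i, j). i < j \<and> j < length xs}.
          case p of (i, j) \<Rightarrow>
            ((\<ominus>\<^bsub>K\<^esub> \<one>\<^bsub>K\<^esub>) [^]\<^bsub>K\<^esub> (i + j)) \<odot>\<^bsub>exterior_power K L (n - 1)\<^esub>
              wedge K L (bracket L (xs ! i) (xs ! j) # nths xs (- {i, j})))"

definition ce_cycles ::
    "('k, 'm) ring_scheme \<Rightarrow> ('k, 'a, 'n) lie_structure_scheme \<Rightarrow> nat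
      \<Rightarrow> ('a list \<Rightarrow> 'k) set set" where
  "ce_cycles K L n =
     a_kernel (exterior_power K L n) (exterior_power K L (n - 1)) (ce_boundary K L n)"

definition ce_boundaries ::
    "('k, 'm) ring_scheme \<Rightarrow> ('k, 'a, 'n) lie_structure_scheme \<Rightarrow> nat
      \<Rightarrow> ('a list \<Rightarrow> 'k) set set" where
  "ce_boundaries K L n = ce_boundary K L (n + 1) ` carrier (exterior_power K L (n + 1))"

definition ce_homology ::
    "('k, 'm) ring_scheme \<Rightarrow> ('k, 'a, 'n) lie_structure_scheme \<Rightarrow> nat
      \<Rightarrow> ('k, ('a list \<Rightarrow> 'k) set set) module" where
  "ce_homology K L n =
     quot_module ((exterior_power K L n)\<lparr>carrier := ce_cycles K L n\<rparr>) (ce_boundaries K L n)"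


section \<open>The Killing module and the Koszul map\<close>

definition killing_map ::
    "('k, 'm) ring_scheme \<Rightarrow> ('k, 'a, 'n) lie_structure_scheme
      \<Rightarrow> ('a list \<Rightarrow> 'k) set \<Rightarrow> ('a list \<Rightarrow> 'k) set" where
  "killing_map K L =
     linear_ext K (sym_square K L)
       (\<lambda>xs. sym_prod K L (bracket L (xs ! 0) (xs ! 1)) (xs ! 2)
              \<ominus>\<^bsub>sym_square K L\<^esub> sym_prod K L (xs ! 0) (bracket L (xs ! 1) (xs ! 2)))"

definition killing_rels ::
    "('k, 'm) ring_scheme \<Rightarrow> ('k, 'a, 'n) lie_structure_scheme \<Rightarrow> ('a list \<Rightarrow> 'k) set set" where
  "killing_rels K L = killing_map K L ` carrier (tensor_power K L 3)"

definition killing_module ::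
    "('k, 'm) ring_scheme \<Rightarrow> ('k, 'a, 'n) lie_structure_scheme
      \<Rightarrow> ('k, ('a list \<Rightarrow> 'k) set set) module" where
  "killing_module K L = quot_module (sym_square K L) (killing_rels K L)"

definition koszul_map ::
    "('k, 'm) ring_scheme \<Rightarrow> ('k, 'a, 'n) lie_structure_scheme
      \<Rightarrow> ('a list \<Rightarrow> 'k) set \<Rightarrow> ('a list \<Rightarrow> 'k) set set" where
  "koszul_map K L =
     linear_ext K (killing_module K L)
       (\<lambda>xs. killing_rels K L
              +>\<^bsub>sym_square K L\<^esub> sym_prod K L (xs ! 0) (bracket L (xs ! 1) (xs ! 2)))"

text \<open>A homology class is a coset of cycles, on which the Koszul map is constant because it
  vanishes on boundaries.\<close>

definition reduced_koszul_map ::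
    "('k, 'm) ring_scheme \<Rightarrow> ('k, 'a, 'n) lie_structure_scheme
      \<Rightarrow> ('a list \<Rightarrow> 'k) set set \<Rightarrow> ('a list \<Rightarrow> 'k) set set" where
  "reduced_koszul_map K L h = the_elem (koszul_map K L ` h)"

definition zero_reduced_koszul_map ::
    "('k, 'm) ring_scheme \<Rightarrow> ('k, 'a, 'n) lie_structure_scheme \<Rightarrow> bool" where
  "zero_reduced_koszul_map K L \<longleftrightarrow>
     (\<forall>h \<in> carrier (ce_homology K L 3).
        reduced_koszul_map K L h = \<zero>\<^bsub>killing_module K L\<^esub>)"

end

theory Submission
  imports Defs
begin

text \<open>If \<open>L\<close> is metabelian, its ideal \<open>I = [L,[L,[L,L]]]\<close> lies in the radical of every invariant
  symmetric form, so the Koszul map of \<open>L\<close> factors through that of the 3-nilpotent quotient \<open>L/I\<close>.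
  Since the chain map induced by \<open>L \<rightarrow> L/I\<close> preserves cycles, vanishing for \<open>L/I\<close> gives vanishing
  for \<open>L\<close>. Conversely, 3-nilpotent Lie algebras are metabelian by the Jacobi identity.\<close>

section \<open>Linear maps, quotients and presentations\<close>

text \<open>The argument runs through \<open>kill_prod\<close>, the universal invariant symmetric
  form, whose values lie in the Killing module. Its radical is contained in that of every other
  invariant symmetric form, so orthogonality is proved once, for this form. A homomorphism induces a
  map of Killing modules in its own direction, from \<open>L\<close> to the quotient, and along it
  the vanishing of the Koszul map cannot be pulled back. What is needed is a map from Kill(L/I) back
  to Kill(L), and it exists because \<open>I\<close> lies in the radical. Much of the work is caused
  by \<open>linear_ext\<close>: a map on a power of \<open>L\<close> has a meaning only after its
  formula on generators is known to respect the relations. So the boundary formula must be shown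
  multilinear and alternating in degrees 3 and 4, and the Koszul formula in degree 3. Degree 4
  enters because a homology class is a coset of the 3-boundaries, and the reduced map is
  single-valued on it only because \<eta> kills these.\<close>

locale linear_map = M: module K M + N: module K N
  for K :: "('k, 'm) ring_scheme" and M :: "('k, 'a, 'n) module_scheme"
    and N :: "('k, 'b, 'p) module_scheme" and f :: "'a \<Rightarrow> 'b" +
  assumes map_closed [simp]: "x \<in> carrier M \<Longrightarrow> f x \<in> carrier N"
    and map_add [simp]:
      "\<lbrakk>x \<in> carrier M; y \<in> carrier M\<rbrakk> \<Longrightarrow> f (x \<oplus>\<^bsub>M\<^esub> y) = f x \<oplus>\<^bsub>N\<^esub> f y"
    and map_smult [simp]:
      "\<lbrakk>c \<in> carrier K; x \<in> carrier M\<rbrakk> \<Longrightarrow> f (c \<odot>\<^bsub>M\<^esub> x) = c \<odot>\<^bsub>N\<^esub> f x"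
begin

lemma map_zero [simp]: "f \<zero>\<^bsub>M\<^esub> = \<zero>\<^bsub>N\<^esub>"
  using map_smult[of "\<zero>\<^bsub>K\<^esub>" "\<zero>\<^bsub>M\<^esub>"] by simp

lemma map_uminus [simp]:
  assumes "x \<in> carrier M" shows "f (\<ominus>\<^bsub>M\<^esub> x) = \<ominus>\<^bsub>N\<^esub> f x"
  using map_add[of "\<ominus>\<^bsub>M\<^esub> x" x] assms by (simp add: M.l_neg N.minus_equality[symmetric])

lemma map_minus [simp]:
  assumes "x \<in> carrier M" "y \<in> carrier M" shows "f (x \<ominus>\<^bsub>M\<^esub> y) = f x \<ominus>\<^bsub>N\<^esub> f y"
  using assms by (simp add: a_minus_def)

text \<open>With \<open>H\<close> the zero submodule this says that kernels are submodules, so that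
  a map killing a set of relations kills their span.\<close>

lemma submodule_vimage:
  assumes "submodule H K N" shows "submodule {x \<in> carrier M. f x \<in> H} K M"
  using N.submoduleE[OF assms] N.submoduleE(1)[OF assms]
  by (intro M.submoduleI) (auto simp: submodule.axioms[OF assms]
      subgroup.one_closed[OF submodule.axioms(1)[OF assms], simplified])

text \<open>Two submodules arise as images later: the Killing relations, which are defined as an
  image and not as a span, and the images of commutators under a homomorphism of Lie
  algebras.\<close>

lemma submodule_image:
  assumes "submodule H K M" shows "submodule (f ` H) K N"
proof -
  note H = M.submoduleE[OF assms]
  have z: "\<zero>\<^bsub>M\<^esub> \<in> H"
    using subgroup.one_closed[OF submodule.axioms(1)[OF assms]] by simp
  show ?thesis
  proof (rule N.submoduleI)
    show "\<zero>\<^bsub>N\<^esub> \<in> f ` H" using z map_zero by (metis image_eqI)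
    show "\<ominus>\<^bsub>N\<^esub> a \<in> f ` H" if "a \<in> f ` H" for a
      using that H(1,3) map_uminus by (force simp: image_iff)
    show "a \<oplus>\<^bsub>N\<^esub> b \<in> f ` H" if "a \<in> f ` H" "b \<in> f ` H" for a b
    proof -
      from that obtain x y where "x \<in> H" "y \<in> H" "a = f x" "b = f y" by auto
      then show ?thesis
        using H(1,5) by (intro image_eqI[of _ _ "x \<oplus>\<^bsub>M\<^esub> y"]) (auto simp: subset_iff)
    qed
    show "c \<odot>\<^bsub>N\<^esub> a \<in> f ` H" if "c \<in> carrier K" "a \<in> f ` H" for c a
    proof -
      from that obtain x where "x \<in> H" "a = f x" by auto
      then show ?thesis
        using that H(1,4) by (intro image_eqI[of _ _ "c \<odot>\<^bsub>M\<^esub> x"]) (auto simp: subset_iff)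
    qed
  qed (use H(1) in auto)
qed

end

lemma linear_mapI:
  assumes "module K M" "module K N"
    and "\<And>x. x \<in> carrier M \<Longrightarrow> f x \<in> carrier N"
    and "\<And>x y. \<lbrakk>x \<in> carrier M; y \<in> carrier M\<rbrakk> \<Longrightarrow> f (x \<oplus>\<^bsub>M\<^esub> y) = f x \<oplus>\<^bsub>N\<^esub> f y"
    and "\<And>c x. \<lbrakk>c \<in> carrier K; x \<in> carrier M\<rbrakk> \<Longrightarrow> f (c \<odot>\<^bsub>M\<^esub> x) = c \<odot>\<^bsub>N\<^esub> f x"
  shows "linear_map K M N f"
  using assms by (simp add: linear_map_def linear_map_axioms_def)

lemma linear_map_comp:
  assumes "linear_map K M N f" "linear_map K N P g"
  shows "linear_map K M P (\<lambda>x. g (f x))"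
proof -
  interpret f: linear_map K M N f by fact
  interpret g: linear_map K N P g by fact
  show ?thesis by (rule linear_mapI) (simp_all add: f.M.module_axioms g.N.module_axioms)
qed

section \<open>Submodules, spans and quotient modules\<close>

context module
begin

lemma uminus_zero [simp]: "\<ominus>\<^bsub>M\<^esub> \<zero>\<^bsub>M\<^esub> = \<zero>\<^bsub>M\<^esub>"
  using M.l_neg[of "\<zero>\<^bsub>M\<^esub>"] by simp

lemma minus_eq_zero_iff [simp]:
  assumes "x \<in> carrier M" "y \<in> carrier M"
  shows "x \<ominus>\<^bsub>M\<^esub> y = \<zero>\<^bsub>M\<^esub> \<longleftrightarrow> x = y"
  using assms M.minus_equality[of x "\<ominus>\<^bsub>M\<^esub> y"] by (auto simp: a_minus_def M.r_neg)

lemma submodule_zero_mem: "submodule H R M \<Longrightarrow> \<zero>\<^bsub>M\<^esub> \<in> H"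
  using subgroup.one_closed[OF submodule.axioms(1)] by fastforce

lemma submodule_zero: "submodule {\<zero>\<^bsub>M\<^esub>} R M"
  by (rule submoduleI) auto

lemma submodule_Inter:
  assumes "\<And>H. H \<in> S \<Longrightarrow> submodule H R M" "S \<noteq> {}"
  shows "submodule (\<Inter>S) R M"
proof (rule submoduleI)
  show "\<Inter>S \<subseteq> carrier M" using assms submoduleE(1) by blast
qed (use assms(1) submodule_zero_mem submoduleE(3,4,5) in blast)+

lemma submodule_span:
  assumes "S \<subseteq> carrier M" shows "submodule (module_span R M S) R M"
  unfolding module_span_def
  by (rule submodule_Inter) (use assms carrier_is_submodule in auto)

lemma span_incl: "x \<in> S \<Longrightarrow> x \<in> module_span R M S"
  unfolding module_span_def by auto

lemma span_minimal: "\<lbrakk>submodule H R M; S \<subseteq> H\<rbrakk> \<Longrightarrow> module_span R M S \<subseteq> H"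
  unfolding module_span_def by auto

text \<open>Every element of \<open>P\<close> is some \<open>p x\<close> and \<open>p\<close> is
  compatible with the operations, so each module axiom is inherited from \<open>M\<close>. The lemma
  creates the module structure on \<open>P\<close>; it serves for cosets and, later, for a system of
  coset representatives.\<close>

lemma module_surjective_image:
  assumes carr: "carrier P = p ` carrier M" and zero: "\<zero>\<^bsub>P\<^esub> = p \<zero>\<^bsub>M\<^esub>"
    and add: "\<And>x y. \<lbrakk>x \<in> carrier M; y \<in> carrier M\<rbrakk> \<Longrightarrow> p x \<oplus>\<^bsub>P\<^esub> p y = p (x \<oplus>\<^bsub>M\<^esub> y)"
    and smult: "\<And>c x. \<lbrakk>c \<in> carrier R; x \<in> carrier M\<rbrakk> \<Longrightarrow> c \<odot>\<^bsub>P\<^esub> p x = p (c \<odot>\<^bsub>M\<^esub> x)"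
  shows "module R P" "linear_map R M P p"
proof -
  show P: "module R P"
  proof (rule moduleI)
    show "abelian_group P"
    proof (rule abelian_groupI)
      fix x assume "x \<in> carrier P"
      then obtain a where "a \<in> carrier M" "x = p a" using carr by auto
      then show "\<exists>y\<in>carrier P. y \<oplus>\<^bsub>P\<^esub> x = \<zero>\<^bsub>P\<^esub>"
        using carr zero by (intro bexI[of _ "p (\<ominus>\<^bsub>M\<^esub> a)"]) (auto simp: add M.l_neg)
    qed (auto simp: carr zero add M.a_ac)
  qed (auto simp: carr zero add smult R.cring_axioms smult_l_distr smult_r_distr smult_assoc1)
  show "linear_map R M P p"
    by (rule linear_mapI) (auto simp: P module_axioms carr add smult)
qed

lemma
  assumes H: "submodule H R M"
  shows quot_module_module: "module R (quot_module M H)"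
    and linear_map_coset: "linear_map R M (quot_module M H) (\<lambda>x. H +>\<^bsub>M\<^esub> x)"
proof -
  interpret H: abelian_subgroup H M
    by (intro abelian_subgroupI3 additive_subgroup.intro submodule.axioms(1)[OF H]
        M.abelian_group_axioms)
  have 1: "carrier (quot_module M H) = (\<lambda>x. H +>\<^bsub>M\<^esub> x) ` carrier M"
    by (auto simp: quot_module_def A_RCOSETS_def')
  have 2: "c \<odot>\<^bsub>quot_module M H\<^esub> (H +>\<^bsub>M\<^esub> x) = H +>\<^bsub>M\<^esub> (c \<odot>\<^bsub>M\<^esub> x)"
    \<comment> \<open>Scaling a coset elementwise need not give a coset: for \<open>c\<close> zero
      only the zero vector is left. The copy of \<open>H\<close> added in the scalar multiplication
      of \<open>quot_module\<close> fills the set up again and absorbs the terms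
      \<open>c \<odot> h\<close>.\<close>
    if c: "c \<in> carrier R" and x: "x \<in> carrier M" for c x
  proof -
    have sub: "h \<in> carrier M" if "h \<in> H" for h using that H.a_subset by auto
    have "H <+>\<^bsub>M\<^esub> (\<lambda>a. c \<odot>\<^bsub>M\<^esub> a) ` (H +>\<^bsub>M\<^esub> x)
        = {k \<oplus>\<^bsub>M\<^esub> (c \<odot>\<^bsub>M\<^esub> h \<oplus>\<^bsub>M\<^esub> c \<odot>\<^bsub>M\<^esub> x) |k h. k \<in> H \<and> h \<in> H}"
      using c x sub by (force simp: set_add_def' a_r_coset_def' smult_r_distr)
    also have "\<dots> = {k \<oplus>\<^bsub>M\<^esub> c \<odot>\<^bsub>M\<^esub> x |k. k \<in> H}"
    proof (intro equalityI subsetI; clarify)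
      fix k h assume kh: "k \<in> H" "h \<in> H"
      then have "k \<oplus>\<^bsub>M\<^esub> c \<odot>\<^bsub>M\<^esub> h \<in> H" using submoduleE(4,5)[OF H] c by auto
      moreover have "k \<oplus>\<^bsub>M\<^esub> (c \<odot>\<^bsub>M\<^esub> h \<oplus>\<^bsub>M\<^esub> c \<odot>\<^bsub>M\<^esub> x) = (k \<oplus>\<^bsub>M\<^esub> c \<odot>\<^bsub>M\<^esub> h) \<oplus>\<^bsub>M\<^esub> c \<odot>\<^bsub>M\<^esub> x"
        using kh c x sub by (simp add: M.a_assoc)
      ultimately show "\<exists>k'. k \<oplus>\<^bsub>M\<^esub> (c \<odot>\<^bsub>M\<^esub> h \<oplus>\<^bsub>M\<^esub> c \<odot>\<^bsub>M\<^esub> x) = k' \<oplus>\<^bsub>M\<^esub> c \<odot>\<^bsub>M\<^esub> x \<and> k' \<in> H"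
        by blast
    next
      fix k assume "k \<in> H"
      then show "\<exists>k' h. k \<oplus>\<^bsub>M\<^esub> c \<odot>\<^bsub>M\<^esub> x = k' \<oplus>\<^bsub>M\<^esub> (c \<odot>\<^bsub>M\<^esub> h \<oplus>\<^bsub>M\<^esub> c \<odot>\<^bsub>M\<^esub> x) \<and> k' \<in> H \<and> h \<in> H"
        using c x submodule_zero_mem[OF H] by (intro exI[of _ k] exI[of _ "\<zero>\<^bsub>M\<^esub>"]) simp
    qed
    also have "\<dots> = H +>\<^bsub>M\<^esub> (c \<odot>\<^bsub>M\<^esub> x)" by (auto simp: a_r_coset_def' image_UN)
    finally show ?thesis by (simp add: quot_module_def)
  qed
  note img = module_surjective_image[OF 1 _ _ 2]
  show "module R (quot_module M H)" "linear_map R M (quot_module M H) (\<lambda>x. H +>\<^bsub>M\<^esub> x)"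
    by (rule img; simp add: quot_module_def H.a_rcos_sum H.a_subset)+
qed

lemma carrier_quot_module: "carrier (quot_module M H) = (\<lambda>x. H +>\<^bsub>M\<^esub> x) ` carrier M"
  by (auto simp: quot_module_def A_RCOSETS_def')

lemma coset_eq_iff:
  assumes H: "submodule H R M" and "x \<in> carrier M" "y \<in> carrier M"
  shows "H +>\<^bsub>M\<^esub> x = H +>\<^bsub>M\<^esub> y \<longleftrightarrow> x \<ominus>\<^bsub>M\<^esub> y \<in> H"
proof -
  interpret H: abelian_subgroup H M
    by (intro abelian_subgroupI3 additive_subgroup.intro submodule.axioms(1)[OF H]
        M.abelian_group_axioms)
  show ?thesis
    using assms H.a_rcos_module[of y x] H.a_rcos_self[of x] M.a_repr_independence[of x H y]
    by (auto simp: M.minus_eq H.a_subgroup)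
qed

lemma coset_eq_zero_iff:
  assumes H: "submodule H R M" and "x \<in> carrier M"
  shows "H +>\<^bsub>M\<^esub> x = \<zero>\<^bsub>quot_module M H\<^esub> \<longleftrightarrow> x \<in> H"
proof -
  have "H +>\<^bsub>M\<^esub> \<zero>\<^bsub>M\<^esub> = \<zero>\<^bsub>quot_module M H\<^esub>"
    by (simp add: quot_module_def submoduleE(1)[OF H])
  moreover have "x \<ominus>\<^bsub>M\<^esub> \<zero>\<^bsub>M\<^esub> = x"
    using M.l_neg[of "\<zero>\<^bsub>M\<^esub>"] assms(2) by (simp add: a_minus_def)
  ultimately show ?thesis using coset_eq_iff[OF H assms(2), of "\<zero>\<^bsub>M\<^esub>"] by simp
qed

end

text \<open>A map vanishing on \<open>H\<close> is constant on the cosets of \<open>H\<close>, so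
  the image of a coset is a singleton and \<open>the_elem\<close> reads off its value. Both
  \<open>linear_ext\<close> and the reduced Koszul map are written in this shape.\<close>

lemma (in linear_map)
  assumes H: "submodule H K M" and van: "\<And>h. h \<in> H \<Longrightarrow> f h = \<zero>\<^bsub>N\<^esub>"
  shows the_elem_coset: "\<And>x. x \<in> carrier M \<Longrightarrow> the_elem (f ` (H +>\<^bsub>M\<^esub> x)) = f x"
    and linear_map_factor: "linear_map K (quot_module M H) N (\<lambda>A. the_elem (f ` A))"
proof -
  show the: "the_elem (f ` (H +>\<^bsub>M\<^esub> x)) = f x" if "x \<in> carrier M" for x
  proof -
    have "f (h \<oplus>\<^bsub>M\<^esub> x) = f x" if "h \<in> H" for h
      using that \<open>x \<in> carrier M\<close> van M.submoduleE(1)[OF H] by (simp add: subset_iff)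
    then have "f ` (H +>\<^bsub>M\<^esub> x) = {f x}"
      using M.submoduleE(2)[OF H] by (auto simp: a_r_coset_def' image_UN)
    then show ?thesis by simp
  qed
  interpret q: linear_map K M "quot_module M H" "\<lambda>x. H +>\<^bsub>M\<^esub> x"
    by (rule M.linear_map_coset[OF H])
  show "linear_map K (quot_module M H) N (\<lambda>A. the_elem (f ` A))"
    by (rule linear_mapI)
      (auto simp: M.quot_module_module[OF H] N.module_axioms M.carrier_quot_module the
        q.map_add[symmetric] q.map_smult[symmetric] simp del: q.map_add q.map_smult)
qed

section \<open>Free modules, and modules given by generators and relations\<close>

lemma carrier_free_module_iff:
  "f \<in> carrier (free_module K X) \<longleftrightarrow>
    (\<forall>x. f x \<in> carrier K) \<and> (\<forall>x. x \<notin> X \<longrightarrow> f x = \<zero>\<^bsub>K\<^esub>) \<and> finite {x. f x \<noteq> \<zero>\<^bsub>K\<^esub>}"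
  by (simp add: free_module_def)

lemma free_module_simps [simp]:
  "\<zero>\<^bsub>free_module K X\<^esub> = (\<lambda>_. \<zero>\<^bsub>K\<^esub>)"
  "f \<oplus>\<^bsub>free_module K X\<^esub> g = (\<lambda>x. f x \<oplus>\<^bsub>K\<^esub> g x)"
  "c \<odot>\<^bsub>free_module K X\<^esub> f = (\<lambda>x. c \<otimes>\<^bsub>K\<^esub> f x)"
  by (simp_all add: free_module_def)

lemma (in cring) free_module_module: "module R (free_module R X)"
proof (rule moduleI)
  show "abelian_group (free_module R X)"
  proof (rule abelian_groupI)
    fix f g assume f: "f \<in> carrier (free_module R X)" and g: "g \<in> carrier (free_module R X)"
    have "finite {x. f x \<oplus> g x \<noteq> \<zero>}"
      by (rule finite_subset[of _ "{x. f x \<noteq> \<zero>} \<union> {x. g x \<noteq> \<zero>}"])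
        (use f g in \<open>auto simp: carrier_free_module_iff\<close>)
    then show "f \<oplus>\<^bsub>free_module R X\<^esub> g \<in> carrier (free_module R X)"
      using f g by (simp add: carrier_free_module_iff)
  next
    fix f assume f: "f \<in> carrier (free_module R X)"
    have "finite {x. \<ominus> f x \<noteq> \<zero>}"
      by (rule finite_subset[of _ "{x. f x \<noteq> \<zero>}"]) (use f in \<open>auto simp: carrier_free_module_iff\<close>)
    then show "\<exists>g\<in>carrier (free_module R X). g \<oplus>\<^bsub>free_module R X\<^esub> f = \<zero>\<^bsub>free_module R X\<^esub>"
      using f by (intro bexI[of _ "\<lambda>x. \<ominus> f x"]) (auto simp: carrier_free_module_iff l_neg)
  qed (auto simp: carrier_free_module_iff a_ac)
next
  fix c f assume c: "c \<in> carrier R" and f: "f \<in> carrier (free_module R X)"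
  have "finite {x. c \<otimes> f x \<noteq> \<zero>}"
    by (rule finite_subset[of _ "{x. f x \<noteq> \<zero>}"]) (use c f in \<open>auto simp: carrier_free_module_iff\<close>)
  then show "c \<odot>\<^bsub>free_module R X\<^esub> f \<in> carrier (free_module R X)"
    using c f by (simp add: carrier_free_module_iff)
qed (auto simp: carrier_free_module_iff cring_axioms l_distr r_distr m_assoc)

lemma (in cring) free_gen_closed [simp]: "x \<in> X \<Longrightarrow> free_gen R x \<in> carrier (free_module R X)"
  using finite_subset[of "{y. free_gen R x y \<noteq> \<zero>}" "{x}"]
  by (auto simp: carrier_free_module_iff free_gen_def)

text \<open>Induction on a finite set containing the support, with one coefficient erased in each
  step. Taking a superset of the support leaves room for the erased coefficient being zero
  already.\<close>

lemma (in cring) linear_map_free_eqI: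
  assumes f: "linear_map R (free_module R X) N f" and g: "linear_map R (free_module R X) N g"
    and gen: "\<And>x. x \<in> X \<Longrightarrow> f (free_gen R x) = g (free_gen R x)"
    and h: "h \<in> carrier (free_module R X)"
  shows "f h = g h"
proof -
  interpret f: linear_map R "free_module R X" N f by fact
  interpret g: linear_map R "free_module R X" N g by fact
  have "f h = g h" if "finite A" "h \<in> carrier (free_module R X)" "{x. h x \<noteq> \<zero>} \<subseteq> A" for A h
    using that
  proof (induction A arbitrary: h rule: finite_induct)
    case empty
    then have "h = \<zero>\<^bsub>free_module R X\<^esub>" by auto
    then show ?case using f.map_zero g.map_zero by metis
  next
    case (insert a A)
    let ?h = "h(a := \<zero>)"
    have h: "\<And>x. h x \<in> carrier R" using insert.prems(1) by (simp add: carrier_free_module_iff)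
    have "finite {x. ?h x \<noteq> \<zero>}"
      by (rule finite_subset[of _ "{x. h x \<noteq> \<zero>}"])
        (use insert.prems(1) in \<open>auto simp: carrier_free_module_iff\<close>)
    then have h': "?h \<in> carrier (free_module R X)"
      using insert.prems(1) by (auto simp: carrier_free_module_iff)
    have IH: "f ?h = g ?h" using insert.prems(2) by (intro insert.IH h') auto
    show ?case
    proof (cases "a \<in> X")
      case True
      then have ga: "free_gen R a \<in> carrier (free_module R X)" by simp
      have "h = ?h \<oplus>\<^bsub>free_module R X\<^esub> h a \<odot>\<^bsub>free_module R X\<^esub> free_gen R a"
        using h by (auto simp: free_gen_def fun_eq_iff)
      moreover have "f (?h \<oplus>\<^bsub>free_module R X\<^esub> h a \<odot>\<^bsub>free_module R X\<^esub> free_gen R a)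
          = g (?h \<oplus>\<^bsub>free_module R X\<^esub> h a \<odot>\<^bsub>free_module R X\<^esub> free_gen R a)"
        using h h' ga IH gen[OF True] f.M.smult_closed[OF h[of a] ga]
        by (simp del: free_module_simps)
      ultimately show ?thesis by metis
    next
      \<comment> \<open>The set \<open>A\<close> may contain points outside \<open>X\<close>, but
        there \<open>h\<close> vanishes and the erasure changes nothing.\<close>
      case False
      then have "?h = h" using insert.prems(1) by (auto simp: carrier_free_module_iff)
      then show ?thesis using IH by simp
    qed
  qed
  then show ?thesis using h by (auto simp: carrier_free_module_iff)
qed

context module
begin

text \<open>The linear extension sums over the support of its argument, which changes under addition
  and scaling. Padding with zero terms allows one common index set for \<open>f\<close>,
  \<open>g\<close> and their sum.\<close>

lemma finsum_superset_support:
  assumes f: "f \<in> carrier (free_module R X)" and \<phi>: "\<And>x. x \<in> X \<Longrightarrow> \<phi> x \<in> carrier M"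
    and A: "finite A" "{x. f x \<noteq> \<zero>} \<subseteq> A" "A \<subseteq> X"
  shows "(\<Oplus>\<^bsub>M\<^esub>x\<in>{x. f x \<noteq> \<zero>}. f x \<odot>\<^bsub>M\<^esub> \<phi> x) = (\<Oplus>\<^bsub>M\<^esub>x\<in>A. f x \<odot>\<^bsub>M\<^esub> \<phi> x)"
  using assms by (intro M.add.finprod_mono_neutral_cong_left)
    (auto simp: carrier_free_module_iff subset_iff)

lemma linear_map_free:
  assumes \<phi>: "\<And>x. x \<in> X \<Longrightarrow> \<phi> x \<in> carrier M"
  shows "linear_map R (free_module R X) M (\<lambda>f. \<Oplus>\<^bsub>M\<^esub>x\<in>{x. f x \<noteq> \<zero>}. f x \<odot>\<^bsub>M\<^esub> \<phi> x)"
proof (rule linear_mapI)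
  interpret F: module R "free_module R X" by (rule free_module_module)
  note supp = finsum_superset_support[OF _ \<phi>]
  show "(\<Oplus>\<^bsub>M\<^esub>x\<in>{x. f x \<noteq> \<zero>}. f x \<odot>\<^bsub>M\<^esub> \<phi> x) \<in> carrier M"
    if "f \<in> carrier (free_module R X)" for f
    using that \<phi> by (intro M.finsum_closed) (auto simp: carrier_free_module_iff)
  show "(\<Oplus>\<^bsub>M\<^esub>x\<in>{x. (f \<oplus>\<^bsub>free_module R X\<^esub> g) x \<noteq> \<zero>}. (f \<oplus>\<^bsub>free_module R X\<^esub> g) x \<odot>\<^bsub>M\<^esub> \<phi> x)
      = (\<Oplus>\<^bsub>M\<^esub>x\<in>{x. f x \<noteq> \<zero>}. f x \<odot>\<^bsub>M\<^esub> \<phi> x) \<oplus>\<^bsub>M\<^esub> (\<Oplus>\<^bsub>M\<^esub>x\<in>{x. g x \<noteq> \<zero>}. g x \<odot>\<^bsub>M\<^esub> \<phi> x)"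
    if f: "f \<in> carrier (free_module R X)" and g: "g \<in> carrier (free_module R X)" for f g
  proof -
    let ?A = "{x. f x \<noteq> \<zero>} \<union> {x. g x \<noteq> \<zero>}"
    have A: "finite ?A" "?A \<subseteq> X" using f g by (auto simp: carrier_free_module_iff)
    have fg: "\<And>x. f x \<in> carrier R" "\<And>x. g x \<in> carrier R"
      using f g by (auto simp: carrier_free_module_iff)
    have s1: "(\<Oplus>\<^bsub>M\<^esub>x\<in>{x. (f \<oplus>\<^bsub>free_module R X\<^esub> g) x \<noteq> \<zero>}. (f \<oplus>\<^bsub>free_module R X\<^esub> g) x \<odot>\<^bsub>M\<^esub> \<phi> x)
        = (\<Oplus>\<^bsub>M\<^esub>x\<in>?A. (f \<oplus>\<^bsub>free_module R X\<^esub> g) x \<odot>\<^bsub>M\<^esub> \<phi> x)"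
      using F.a_closed[OF f g] A(2) by (intro supp A(1)) auto
    have s2: "(\<Oplus>\<^bsub>M\<^esub>x\<in>?A. (f \<oplus>\<^bsub>free_module R X\<^esub> g) x \<odot>\<^bsub>M\<^esub> \<phi> x)
        = (\<Oplus>\<^bsub>M\<^esub>x\<in>?A. f x \<odot>\<^bsub>M\<^esub> \<phi> x \<oplus>\<^bsub>M\<^esub> g x \<odot>\<^bsub>M\<^esub> \<phi> x)"
      using fg A(2) \<phi> by (intro M.finsum_cong') (auto simp: smult_l_distr)
    have s3: "(\<Oplus>\<^bsub>M\<^esub>x\<in>?A. f x \<odot>\<^bsub>M\<^esub> \<phi> x \<oplus>\<^bsub>M\<^esub> g x \<odot>\<^bsub>M\<^esub> \<phi> x)
        = (\<Oplus>\<^bsub>M\<^esub>x\<in>?A. f x \<odot>\<^bsub>M\<^esub> \<phi> x) \<oplus>\<^bsub>M\<^esub> (\<Oplus>\<^bsub>M\<^esub>x\<in>?A. g x \<odot>\<^bsub>M\<^esub> \<phi> x)"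
      using fg A(2) \<phi> by (intro M.finsum_addf) auto
    have s4: "(\<Oplus>\<^bsub>M\<^esub>x\<in>{x. f x \<noteq> \<zero>}. f x \<odot>\<^bsub>M\<^esub> \<phi> x) = (\<Oplus>\<^bsub>M\<^esub>x\<in>?A. f x \<odot>\<^bsub>M\<^esub> \<phi> x)"
      "(\<Oplus>\<^bsub>M\<^esub>x\<in>{x. g x \<noteq> \<zero>}. g x \<odot>\<^bsub>M\<^esub> \<phi> x) = (\<Oplus>\<^bsub>M\<^esub>x\<in>?A. g x \<odot>\<^bsub>M\<^esub> \<phi> x)"
      using f g A(2) by (auto intro!: supp A(1))
    show ?thesis unfolding s1 s2 s3 s4 ..
  qed
  show "(\<Oplus>\<^bsub>M\<^esub>x\<in>{x. (c \<odot>\<^bsub>free_module R X\<^esub> f) x \<noteq> \<zero>}. (c \<odot>\<^bsub>free_module R X\<^esub> f) x \<odot>\<^bsub>M\<^esub> \<phi> x)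
      = c \<odot>\<^bsub>M\<^esub> (\<Oplus>\<^bsub>M\<^esub>x\<in>{x. f x \<noteq> \<zero>}. f x \<odot>\<^bsub>M\<^esub> \<phi> x)"
    if c: "c \<in> carrier R" and f: "f \<in> carrier (free_module R X)" for c f
  proof -
    let ?A = "{x. f x \<noteq> \<zero>}"
    have A: "finite ?A" "?A \<subseteq> X" and fx: "\<And>x. f x \<in> carrier R"
      using f by (auto simp: carrier_free_module_iff)
    have s1: "(\<Oplus>\<^bsub>M\<^esub>x\<in>{x. (c \<odot>\<^bsub>free_module R X\<^esub> f) x \<noteq> \<zero>}. (c \<odot>\<^bsub>free_module R X\<^esub> f) x \<odot>\<^bsub>M\<^esub> \<phi> x)
        = (\<Oplus>\<^bsub>M\<^esub>x\<in>?A. (c \<odot>\<^bsub>free_module R X\<^esub> f) x \<odot>\<^bsub>M\<^esub> \<phi> x)"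
      using F.smult_closed[OF c f] c A(2) by (intro supp A(1)) auto
    have s2: "c \<odot>\<^bsub>M\<^esub> (\<Oplus>\<^bsub>M\<^esub>x\<in>?A. f x \<odot>\<^bsub>M\<^esub> \<phi> x) = (\<Oplus>\<^bsub>M\<^esub>x\<in>?A. c \<odot>\<^bsub>M\<^esub> (f x \<odot>\<^bsub>M\<^esub> \<phi> x))"
      using fx A \<phi> c by (intro finsum_smult_ldistr) auto
    show ?thesis
      unfolding s1 s2 using fx A(2) \<phi> c by (intro M.finsum_cong') (auto simp: smult_assoc1)
  qed
qed (auto simp: free_module_module module_axioms)

lemma finsum_free_gen:
  assumes "x \<in> X" "\<And>x. x \<in> X \<Longrightarrow> \<phi> x \<in> carrier M"
  shows "(\<Oplus>\<^bsub>M\<^esub>y\<in>{y. free_gen R x y \<noteq> \<zero>}. free_gen R x y \<odot>\<^bsub>M\<^esub> \<phi> y) = \<phi> x"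
proof -
  have "(\<Oplus>\<^bsub>M\<^esub>y\<in>{y. free_gen R x y \<noteq> \<zero>}. free_gen R x y \<odot>\<^bsub>M\<^esub> \<phi> y)
      = (\<Oplus>\<^bsub>M\<^esub>y\<in>{x}. free_gen R x y \<odot>\<^bsub>M\<^esub> \<phi> y)"
    using assms by (intro finsum_superset_support[of _ X]) (auto, auto simp: free_gen_def split: if_splits)
  then show ?thesis using assms by (simp add: free_gen_def)
qed

text \<open>Existence half of the universal property of generators and relations. The kernel of the
  linear extension is a submodule, so it contains the span of the relations as soon as it contains
  the relations; hence the extension is constant on cosets, which is the proviso attached to
  \<open>linear_ext\<close>.\<close>

lemma
  assumes \<phi>: "\<And>x. x \<in> X \<Longrightarrow> \<phi> x \<in> carrier M"
    and rel: "rel \<subseteq> carrier (free_module R X)"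
    and van: "\<And>r. r \<in> rel \<Longrightarrow> (\<Oplus>\<^bsub>M\<^esub>x\<in>{x. r x \<noteq> \<zero>}. r x \<odot>\<^bsub>M\<^esub> \<phi> x) = \<zero>\<^bsub>M\<^esub>"
  shows linear_map_linear_ext: "linear_map R (presented_module R X rel) M (linear_ext R M \<phi>)"
    and linear_ext_gen: "\<And>x. x \<in> X \<Longrightarrow> linear_ext R M \<phi> (presented_gen R X rel x) = \<phi> x"
proof -
  let ?e = "\<lambda>f. \<Oplus>\<^bsub>M\<^esub>x\<in>{x. f x \<noteq> \<zero>}. f x \<odot>\<^bsub>M\<^esub> \<phi> x"
  interpret e: linear_map R "free_module R X" M ?e by (rule linear_map_free[OF \<phi>])
  have sub: "submodule (module_span R (free_module R X) rel) R (free_module R X)"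
    by (rule e.M.submodule_span[OF rel])
  have "module_span R (free_module R X) rel \<subseteq> {f \<in> carrier (free_module R X). ?e f \<in> {\<zero>\<^bsub>M\<^esub>}}"
    using rel van by (intro e.M.span_minimal e.submodule_vimage submodule_zero) auto
  then have van': "\<And>f. f \<in> module_span R (free_module R X) rel \<Longrightarrow> ?e f = \<zero>\<^bsub>M\<^esub>" by auto
  show "linear_map R (presented_module R X rel) M (linear_ext R M \<phi>)"
    using e.linear_map_factor[OF sub van'] by (simp add: presented_module_def linear_ext_def[abs_def])
  show "linear_ext R M \<phi> (presented_gen R X rel x) = \<phi> x" if "x \<in> X" for x
    unfolding linear_ext_def presented_gen_def
    using e.the_elem_coset[OF sub van', of "free_gen R x"] that finsum_free_gen[of x X \<phi>] \<phi> by simp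
qed

end

context cring
begin

lemma
  assumes "rel \<subseteq> carrier (free_module R X)"
  shows presented_module_module: "module R (presented_module R X rel)"
    and linear_map_presented: "linear_map R (free_module R X) (presented_module R X rel)
      (\<lambda>f. module_span R (free_module R X) rel +>\<^bsub>free_module R X\<^esub> f)"
    and presented_gen_closed: "\<And>x. x \<in> X \<Longrightarrow> presented_gen R X rel x \<in> carrier (presented_module R X rel)"
    and presented_rel: "\<And>r. r \<in> rel \<Longrightarrow> module_span R (free_module R X) rel +>\<^bsub>free_module R X\<^esub> r
      = \<zero>\<^bsub>presented_module R X rel\<^esub>"
proof -
  interpret F: module R "free_module R X" by (rule free_module_module)
  note sub = F.submodule_span[OF assms]
  show "module R (presented_module R X rel)"
    unfolding presented_module_def by (rule F.quot_module_module[OF sub])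
  show lin: "linear_map R (free_module R X) (presented_module R X rel)
      (\<lambda>f. module_span R (free_module R X) rel +>\<^bsub>free_module R X\<^esub> f)"
    unfolding presented_module_def by (rule F.linear_map_coset[OF sub])
  show "presented_gen R X rel x \<in> carrier (presented_module R X rel)" if "x \<in> X" for x
    unfolding presented_gen_def using linear_map.map_closed[OF lin] that by simp
  show "module_span R (free_module R X) rel +>\<^bsub>free_module R X\<^esub> r = \<zero>\<^bsub>presented_module R X rel\<^esub>"
    if "r \<in> rel" for r
    unfolding presented_module_def
    using F.coset_eq_zero_iff[OF sub] F.span_incl[OF that] that assms by auto
qed

text \<open>Uniqueness half of the universal property: composing with the projection from the free
  module reduces it to a comparison on free generators.\<close>

lemma linear_map_presented_eqI:
  assumes rel: "rel \<subseteq> carrier (free_module R X)"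
    and f: "linear_map R (presented_module R X rel) N f"
    and g: "linear_map R (presented_module R X rel) N g"
    and gen: "\<And>x. x \<in> X \<Longrightarrow> f (presented_gen R X rel x) = g (presented_gen R X rel x)"
    and h: "h \<in> carrier (presented_module R X rel)"
  shows "f h = g h"
proof -
  interpret F: module R "free_module R X" by (rule free_module_module)
  note p = linear_map_presented[OF rel]
  obtain a where "a \<in> carrier (free_module R X)"
    "h = module_span R (free_module R X) rel +>\<^bsub>free_module R X\<^esub> a"
    using h unfolding presented_module_def F.carrier_quot_module by auto
  then show ?thesis
    using linear_map_free_eqI[OF linear_map_comp[OF p f] linear_map_comp[OF p g]] gen
    by (simp add: presented_gen_def)
qed

end

section \<open>Multilinear maps\<close>

text \<open>Position \<open>i\<close> of \<open>xs\<close> is overwritten in every term, so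
  \<open>xs\<close> only supplies the other arguments. In this form the two clauses match the two
  families of \<open>multilinear_rels\<close>.\<close>

definition multilinear ::
    "('k, 'm) ring_scheme \<Rightarrow> ('k, 'a, 'n) module_scheme \<Rightarrow> ('k, 'b, 'p) module_scheme \<Rightarrow> nat
      \<Rightarrow> ('a list \<Rightarrow> 'b) \<Rightarrow> bool" where
  "multilinear K L N n \<phi> \<longleftrightarrow>
     (\<forall>xs\<in>tuples L n. \<phi> xs \<in> carrier N) \<and>
     (\<forall>xs\<in>tuples L n. \<forall>i<n. \<forall>x\<in>carrier L.
       (\<forall>y\<in>carrier L. \<phi> (xs[i := x \<oplus>\<^bsub>L\<^esub> y]) = \<phi> (xs[i := x]) \<oplus>\<^bsub>N\<^esub> \<phi> (xs[i := y])) \<and>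
       (\<forall>c\<in>carrier K. \<phi> (xs[i := c \<odot>\<^bsub>L\<^esub> x]) = c \<odot>\<^bsub>N\<^esub> \<phi> (xs[i := x])))"

lemma tuples_update [simp]: "\<lbrakk>xs \<in> tuples L n; x \<in> carrier L\<rbrakk> \<Longrightarrow> xs[i := x] \<in> tuples L n"
  using set_update_subset_insert[of xs i x] by (auto simp: tuples_def)

lemma tuples_Suc: "tuples L (Suc n) = {x # xs |x xs. x \<in> carrier L \<and> xs \<in> tuples L n}"
  by (auto simp: tuples_def length_Suc_conv)

lemma tuples_0: "tuples L 0 = {[]}"
  by (auto simp: tuples_def)

lemmas tuples_explicit = eval_nat_numeral tuples_Suc tuples_0

section \<open>Universal properties of tensor powers, exterior powers and the symmetric
  square\<close>

context module
begin

lemma multilinear_rels_closed: "multilinear_rels R M n \<subseteq> carrier (free_module R (tuples M n))"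
proof -
  interpret F: module R "free_module R (tuples M n)" by (rule free_module_module)
  show ?thesis
    unfolding multilinear_rels_def Let_def
    by (auto simp del: free_module_simps intro!: F.minus_closed F.a_closed F.smult_closed free_gen_closed)
qed

lemma exterior_rels_closed: "exterior_rels R M n \<subseteq> carrier (free_module R (tuples M n))"
  using multilinear_rels_closed by (auto simp: exterior_rels_def)

lemma pair_in_tuples: "\<lbrakk>x \<in> carrier M; y \<in> carrier M\<rbrakk> \<Longrightarrow> [x, y] \<in> tuples M 2"
  by (simp add: tuples_def)

lemma sym_square_rels_closed: "sym_square_rels R M \<subseteq> carrier (free_module R (tuples M 2))"
proof -
  interpret F: module R "free_module R (tuples M 2)" by (rule free_module_module)
  show ?thesis
    using multilinear_rels_closed by (auto simp: sym_square_rels_def pair_in_tuples)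
qed

text \<open>Each multilinear relation has class zero in the quotient, which is additivity or
  homogeneity of the generator map in one slot. The set \<open>rel\<close> may be larger, so
  exterior powers and the symmetric square are covered together.\<close>

lemma multilinear_presented_gen:
  assumes rel: "rel \<subseteq> carrier (free_module R (tuples M n))" and mul: "multilinear_rels R M n \<subseteq> rel"
  shows "multilinear R M (presented_module R (tuples M n) rel) n (presented_gen R (tuples M n) rel)"
proof -
  let ?F = "free_module R (tuples M n)" and ?P = "presented_module R (tuples M n) rel"
  interpret P: linear_map R ?F ?P "\<lambda>f. module_span R ?F rel +>\<^bsub>?F\<^esub> f"
    by (rule linear_map_presented[OF rel])
  note [simp del] = free_module_simps
  have "presented_gen R (tuples M n) rel (xs[i := x \<oplus>\<^bsub>M\<^esub> y])
      = presented_gen R (tuples M n) rel (xs[i := x]) \<oplus>\<^bsub>?P\<^esub> presented_gen R (tuples M n) rel (xs[i := y])"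
    if "xs \<in> tuples M n" "i < n" "x \<in> carrier M" "y \<in> carrier M" for xs i x y
  proof -
    have "free_gen R (xs[i := x \<oplus>\<^bsub>M\<^esub> y])
          \<ominus>\<^bsub>?F\<^esub> (free_gen R (xs[i := x]) \<oplus>\<^bsub>?F\<^esub> free_gen R (xs[i := y])) \<in> rel"
      using that by (intro subsetD[OF mul[unfolded multilinear_rels_def Let_def]] UnI1 CollectI)
        (rule exI[of _ xs], rule exI[of _ i], rule exI[of _ x], rule exI[of _ y], simp)
    from presented_rel[OF rel this] show ?thesis
      using that by (simp add: presented_gen_def)
  qed
  moreover have "presented_gen R (tuples M n) rel (xs[i := c \<odot>\<^bsub>M\<^esub> x])
      = c \<odot>\<^bsub>?P\<^esub> presented_gen R (tuples M n) rel (xs[i := x])"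
    if "xs \<in> tuples M n" "i < n" "x \<in> carrier M" "c \<in> carrier R" for xs i x c
  proof -
    have "free_gen R (xs[i := c \<odot>\<^bsub>M\<^esub> x]) \<ominus>\<^bsub>?F\<^esub> c \<odot>\<^bsub>?F\<^esub> free_gen R (xs[i := x]) \<in> rel"
      using that by (intro subsetD[OF mul[unfolded multilinear_rels_def Let_def]] UnI2 CollectI)
        (rule exI[of _ xs], rule exI[of _ i], rule exI[of _ c], rule exI[of _ x], simp)
    from presented_rel[OF rel this] show ?thesis
      using that by (simp add: presented_gen_def)
  qed
  ultimately show ?thesis
    by (simp add: multilinear_def presented_gen_closed[OF rel])
qed

lemma finsum_multilinear_rel:
  assumes N: "module R N" and mul: "multilinear R M N n \<phi>" and r: "r \<in> multilinear_rels R M n"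
  shows "(\<Oplus>\<^bsub>N\<^esub>x\<in>{x. r x \<noteq> \<zero>}. r x \<odot>\<^bsub>N\<^esub> \<phi> x) = \<zero>\<^bsub>N\<^esub>"
proof -
  let ?F = "free_module R (tuples M n)" and ?e = "\<lambda>f. \<Oplus>\<^bsub>N\<^esub>x\<in>{x. f x \<noteq> \<zero>}. f x \<odot>\<^bsub>N\<^esub> \<phi> x"
  interpret N: module R N by fact
  have \<phi>: "\<And>xs. xs \<in> tuples M n \<Longrightarrow> \<phi> xs \<in> carrier N" using mul by (simp add: multilinear_def)
  interpret e: linear_map R ?F N ?e by (rule N.linear_map_free[OF \<phi>])
  note [simp del] = free_module_simps
  note gen = N.finsum_free_gen[where X = "tuples M n" and \<phi> = \<phi>, OF _ \<phi>]
  show ?thesis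
    using r mul unfolding multilinear_rels_def Let_def
    by (auto simp: gen \<phi> multilinear_def)
qed

text \<open>Alternation is asked for as vanishing on lists with a repeated entry, as in
  \<open>exterior_rels\<close>; a sign rule for transpositions would be weaker in characteristic
  2.\<close>

lemma
  assumes N: "module R N" and mul: "multilinear R M N n \<phi>"
    and alt: "\<And>xs. \<lbrakk>xs \<in> tuples M n; \<not> distinct xs\<rbrakk> \<Longrightarrow> \<phi> xs = \<zero>\<^bsub>N\<^esub>"
  shows linear_map_exterior: "linear_map R (exterior_power R M n) N (linear_ext R N \<phi>)"
    and linear_ext_wedge: "\<And>xs. xs \<in> tuples M n \<Longrightarrow> linear_ext R N \<phi> (wedge R M xs) = \<phi> xs"
proof -
  interpret N: module R N by fact
  have \<phi>: "\<And>xs. xs \<in> tuples M n \<Longrightarrow> \<phi> xs \<in> carrier N" using mul by (simp add: multilinear_def)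
  have van: "(\<Oplus>\<^bsub>N\<^esub>x\<in>{x. r x \<noteq> \<zero>}. r x \<odot>\<^bsub>N\<^esub> \<phi> x) = \<zero>\<^bsub>N\<^esub>" if "r \<in> exterior_rels R M n" for r
    using that finsum_multilinear_rel[OF N mul] N.finsum_free_gen[of _ "tuples M n" \<phi>, OF _ \<phi>] alt
    by (auto simp: exterior_rels_def)
  show "linear_map R (exterior_power R M n) N (linear_ext R N \<phi>)"
    unfolding exterior_power_def by (rule N.linear_map_linear_ext[OF \<phi> exterior_rels_closed van])
  show "linear_ext R N \<phi> (wedge R M xs) = \<phi> xs" if "xs \<in> tuples M n" for xs
    using N.linear_ext_gen[OF \<phi> exterior_rels_closed van, where x = xs] that
    by (auto simp: wedge_def tuples_def)
qed

lemma
  assumes N: "module R N" and mul: "multilinear R M N n \<phi>"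
  shows linear_map_tensor: "linear_map R (tensor_power R M n) N (linear_ext R N \<phi>)"
    and linear_ext_tensor: "\<And>xs. xs \<in> tuples M n
      \<Longrightarrow> linear_ext R N \<phi> (presented_gen R (tuples M n) (multilinear_rels R M n) xs) = \<phi> xs"
proof -
  interpret N: module R N by fact
  have \<phi>: "\<And>xs. xs \<in> tuples M n \<Longrightarrow> \<phi> xs \<in> carrier N" using mul by (simp add: multilinear_def)
  note van = finsum_multilinear_rel[OF N mul]
  show "linear_map R (tensor_power R M n) N (linear_ext R N \<phi>)"
    unfolding tensor_power_def by (rule N.linear_map_linear_ext[OF \<phi> multilinear_rels_closed van])
  show "linear_ext R N \<phi> (presented_gen R (tuples M n) (multilinear_rels R M n) xs) = \<phi> xs"
    if "xs \<in> tuples M n" for xs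
    using N.linear_ext_gen[OF \<phi> multilinear_rels_closed van] that by simp
qed

lemma
  assumes N: "module R N" and mul: "multilinear R M N 2 \<phi>"
    and sym: "\<And>x y. \<lbrakk>x \<in> carrier M; y \<in> carrier M\<rbrakk> \<Longrightarrow> \<phi> [x, y] = \<phi> [y, x]"
  shows linear_map_sym_square: "linear_map R (sym_square R M) N (linear_ext R N \<phi>)"
    and linear_ext_sym_prod: "\<And>x y. \<lbrakk>x \<in> carrier M; y \<in> carrier M\<rbrakk>
      \<Longrightarrow> linear_ext R N \<phi> (sym_prod R M x y) = \<phi> [x, y]"
proof -
  let ?e = "\<lambda>f. \<Oplus>\<^bsub>N\<^esub>x\<in>{x. f x \<noteq> \<zero>}. f x \<odot>\<^bsub>N\<^esub> \<phi> x"
  interpret N: module R N by fact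
  have \<phi>: "\<And>xs. xs \<in> tuples M 2 \<Longrightarrow> \<phi> xs \<in> carrier N" using mul by (simp add: multilinear_def)
  interpret e: linear_map R "free_module R (tuples M 2)" N ?e by (rule N.linear_map_free[OF \<phi>])
  note [simp del] = free_module_simps
  note gen = N.finsum_free_gen[where X = "tuples M 2" and \<phi> = \<phi>, OF _ \<phi>]
  have "?e (free_gen R [x, y] \<ominus>\<^bsub>free_module R (tuples M 2)\<^esub> free_gen R [y, x]) = \<zero>\<^bsub>N\<^esub>"
    if "x \<in> carrier M" "y \<in> carrier M" for x y
    using that sym[of x y] by (simp add: gen \<phi> pair_in_tuples)
  then have van: "?e r = \<zero>\<^bsub>N\<^esub>" if "r \<in> sym_square_rels R M" for r
    using that finsum_multilinear_rel[OF N mul, of r] by (auto simp: sym_square_rels_def)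
  show "linear_map R (sym_square R M) N (linear_ext R N \<phi>)"
    unfolding sym_square_def by (rule N.linear_map_linear_ext[OF \<phi> sym_square_rels_closed van])
  show "linear_ext R N \<phi> (sym_prod R M x y) = \<phi> [x, y]" if "x \<in> carrier M" "y \<in> carrier M" for x y
    using N.linear_ext_gen[OF \<phi> sym_square_rels_closed van] that
    by (auto simp: sym_prod_def pair_in_tuples)
qed

lemma exterior_power_module: "module R (exterior_power R M n)"
  unfolding exterior_power_def by (rule presented_module_module[OF exterior_rels_closed])

lemma sym_square_module: "module R (sym_square R M)"
  unfolding sym_square_def by (rule presented_module_module[OF sym_square_rels_closed])

lemma multilinear_wedge: "multilinear R M (exterior_power R M n) n (wedge R M)"
proof -
  have "multilinear R M (exterior_power R M n) n
      (presented_gen R (tuples M n) (exterior_rels R M n))"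
    unfolding exterior_power_def
    by (rule multilinear_presented_gen[OF exterior_rels_closed]) (simp add: exterior_rels_def)
  then show ?thesis
    by (simp add: multilinear_def wedge_def tuples_def)
qed

lemma wedge_not_distinct:
  assumes "xs \<in> tuples M n" "\<not> distinct xs"
  shows "wedge R M xs = \<zero>\<^bsub>exterior_power R M n\<^esub>"
  using presented_rel[OF exterior_rels_closed, of "free_gen R xs" n] assms
  by (auto simp: exterior_rels_def wedge_def presented_gen_def exterior_power_def tuples_def)

lemma multilinear_sym_prod: "multilinear R M (sym_square R M) 2 (\<lambda>xs. sym_prod R M (xs ! 0) (xs ! 1))"
proof -
  have "multilinear R M (sym_square R M) 2 (presented_gen R (tuples M 2) (sym_square_rels R M))"
    unfolding sym_square_def
    by (rule multilinear_presented_gen[OF sym_square_rels_closed]) (simp add: sym_square_rels_def)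
  moreover have "xs = [xs ! 0, xs ! 1]" if "length xs = 2" for xs :: "'c list"
    using that by (auto simp: numeral_2_eq_2 length_Suc_conv)
  ultimately show ?thesis
    by (simp add: multilinear_def sym_prod_def tuples_def)
qed

lemma sym_prod_commute:
  assumes "x \<in> carrier M" "y \<in> carrier M"
  shows "sym_prod R M x y = sym_prod R M y x"
proof -
  let ?F = "free_module R (tuples M 2)"
  interpret P: linear_map R ?F "presented_module R (tuples M 2) (sym_square_rels R M)"
    "\<lambda>f. module_span R ?F (sym_square_rels R M) +>\<^bsub>?F\<^esub> f"
    by (rule linear_map_presented[OF sym_square_rels_closed])
  note [simp del] = free_module_simps
  have "free_gen R [x, y] \<ominus>\<^bsub>?F\<^esub> free_gen R [y, x] \<in> sym_square_rels R M"
    using assms by (auto simp: sym_square_rels_def)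
  from presented_rel[OF sym_square_rels_closed this] show ?thesis
    using assms by (simp add: sym_prod_def presented_gen_def pair_in_tuples)
qed

lemma linear_map_exterior_eqI:
  assumes "linear_map R (exterior_power R M n) N f" "linear_map R (exterior_power R M n) N g"
    and "\<And>xs. xs \<in> tuples M n \<Longrightarrow> f (wedge R M xs) = g (wedge R M xs)"
    and "h \<in> carrier (exterior_power R M n)"
  shows "f h = g h"
  using assms(3)
  by (intro linear_map_presented_eqI[OF exterior_rels_closed
        assms(1)[unfolded exterior_power_def]
        assms(2)[unfolded exterior_power_def] _ assms(4)[unfolded exterior_power_def]]) (auto simp: wedge_def tuples_def)

end

context module
begin

lemma multilinear_cong:
  assumes "multilinear R M N n \<phi>" "\<And>xs. xs \<in> tuples M n \<Longrightarrow> \<phi> xs = \<psi> xs"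
  shows "multilinear R M N n \<psi>"
  using assms by (simp add: multilinear_def)

lemma multilinear_add:
  assumes "module R N" "multilinear R M N n \<phi>" "multilinear R M N n \<psi>"
  shows "multilinear R M N n (\<lambda>xs. \<phi> xs \<oplus>\<^bsub>N\<^esub> \<psi> xs)"
proof -
  interpret N: module R N by fact
  show ?thesis
    using assms(2,3) unfolding multilinear_def by (auto simp: N.smult_r_distr N.M.a_ac)
qed

lemma multilinear_minus:
  assumes "module R N" "multilinear R M N n \<phi>" "multilinear R M N n \<psi>"
  shows "multilinear R M N n (\<lambda>xs. \<phi> xs \<ominus>\<^bsub>N\<^esub> \<psi> xs)"
proof -
  interpret N: module R N by fact
  show ?thesis
    using assms(2,3) unfolding multilinear_def
    by (auto simp: N.smult_r_distr N.M.a_ac a_minus_def N.smult_r_minus N.M.minus_add)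
qed

end

section \<open>Multilinearity in two, three and four variables, slot by slot\<close>

lemma multilinear_2I:
  assumes closed: "\<And>a b. \<lbrakk>a \<in> carrier L; b \<in> carrier L\<rbrakk> \<Longrightarrow> \<phi> [a, b] \<in> carrier N"
    and add: "\<And>a b x. \<lbrakk>a \<in> carrier L; b \<in> carrier L; x \<in> carrier L\<rbrakk>
        \<Longrightarrow> \<phi> [a \<oplus>\<^bsub>L\<^esub> x, b] = \<phi> [a, b] \<oplus>\<^bsub>N\<^esub> \<phi> [x, b]"
      "\<And>a b x. \<lbrakk>a \<in> carrier L; b \<in> carrier L; x \<in> carrier L\<rbrakk>
        \<Longrightarrow> \<phi> [a, b \<oplus>\<^bsub>L\<^esub> x] = \<phi> [a, b] \<oplus>\<^bsub>N\<^esub> \<phi> [a, x]"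
    and smult: "\<And>a b k. \<lbrakk>a \<in> carrier L; b \<in> carrier L; k \<in> carrier K\<rbrakk>
        \<Longrightarrow> \<phi> [k \<odot>\<^bsub>L\<^esub> a, b] = k \<odot>\<^bsub>N\<^esub> \<phi> [a, b]"
      "\<And>a b k. \<lbrakk>a \<in> carrier L; b \<in> carrier L; k \<in> carrier K\<rbrakk>
        \<Longrightarrow> \<phi> [a, k \<odot>\<^bsub>L\<^esub> b] = k \<odot>\<^bsub>N\<^esub> \<phi> [a, b]"
  shows "multilinear K L N 2 \<phi>"
proof -
  have xs: "\<exists>a b. xs = [a, b] \<and> {a, b} \<subseteq> carrier L" if "xs \<in> tuples L 2" for xs
    using that by (auto simp: tuples_explicit)
  show ?thesis
    unfolding multilinear_def
  proof (intro conjI ballI allI impI)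
    fix xs assume "xs \<in> tuples L 2"
    from xs[OF this] closed show "\<phi> xs \<in> carrier N" by auto
  next
    fix xs x y and i :: nat assume *: "xs \<in> tuples L 2" "i < 2" "x \<in> carrier L" "y \<in> carrier L"
    consider "i = 0" | "i = 1" using *(2) by linarith
    then show "\<phi> (xs[i := x \<oplus>\<^bsub>L\<^esub> y]) = \<phi> (xs[i := x]) \<oplus>\<^bsub>N\<^esub> \<phi> (xs[i := y])"
      using xs[OF *(1)] *(3,4) add by cases (auto simp: numeral_nat)
  next
    fix xs k x and i :: nat assume *: "xs \<in> tuples L 2" "i < 2" "x \<in> carrier L" "k \<in> carrier K"
    consider "i = 0" | "i = 1" using *(2) by linarith
    then show "\<phi> (xs[i := k \<odot>\<^bsub>L\<^esub> x]) = k \<odot>\<^bsub>N\<^esub> \<phi> (xs[i := x])"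
      using xs[OF *(1)] *(3,4) smult by cases (auto simp: numeral_nat)
  qed
qed

lemma multilinear_2D:
  assumes "multilinear K L N 2 \<phi>" "a \<in> carrier L" "b \<in> carrier L"
  shows "\<phi> [a, b] \<in> carrier N"
    and "x \<in> carrier L \<Longrightarrow> \<phi> [a \<oplus>\<^bsub>L\<^esub> x, b] = \<phi> [a, b] \<oplus>\<^bsub>N\<^esub> \<phi> [x, b]"
    and "x \<in> carrier L \<Longrightarrow> \<phi> [a, b \<oplus>\<^bsub>L\<^esub> x] = \<phi> [a, b] \<oplus>\<^bsub>N\<^esub> \<phi> [a, x]"
    and "k \<in> carrier K \<Longrightarrow> \<phi> [k \<odot>\<^bsub>L\<^esub> a, b] = k \<odot>\<^bsub>N\<^esub> \<phi> [a, b]"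
    and "k \<in> carrier K \<Longrightarrow> \<phi> [a, k \<odot>\<^bsub>L\<^esub> b] = k \<odot>\<^bsub>N\<^esub> \<phi> [a, b]"
proof -
  have t: "[a, b] \<in> tuples L 2" using assms by (simp add: tuples_def)
  show "\<phi> [a, b] \<in> carrier N" using assms(1) t by (simp add: multilinear_def)
  note mul = assms(1)[unfolded multilinear_def, THEN conjunct2, rule_format, OF t]
  show "\<phi> [a \<oplus>\<^bsub>L\<^esub> x, b] = \<phi> [a, b] \<oplus>\<^bsub>N\<^esub> \<phi> [x, b]" if "x \<in> carrier L"
    using mul[of 0 a, THEN conjunct1] that assms by (simp add: numeral_nat)
  show "\<phi> [a, b \<oplus>\<^bsub>L\<^esub> x] = \<phi> [a, b] \<oplus>\<^bsub>N\<^esub> \<phi> [a, x]" if "x \<in> carrier L"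
    using mul[of 1 b, THEN conjunct1] that assms by (simp add: numeral_nat)
  show "\<phi> [k \<odot>\<^bsub>L\<^esub> a, b] = k \<odot>\<^bsub>N\<^esub> \<phi> [a, b]" if "k \<in> carrier K"
    using mul[of 0 a, THEN conjunct2] that assms by (simp add: numeral_nat)
  show "\<phi> [a, k \<odot>\<^bsub>L\<^esub> b] = k \<odot>\<^bsub>N\<^esub> \<phi> [a, b]" if "k \<in> carrier K"
    using mul[of 1 b, THEN conjunct2] that assms by (simp add: numeral_nat)
qed

lemma multilinear_3I:
  assumes closed: "\<And>a b c. \<lbrakk>a \<in> carrier L; b \<in> carrier L; c \<in> carrier L\<rbrakk> \<Longrightarrow> \<phi> [a, b, c] \<in> carrier N"
    and add: "\<And>a b c x. \<lbrakk>a \<in> carrier L; b \<in> carrier L; c \<in> carrier L; x \<in> carrier L\<rbrakk>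
        \<Longrightarrow> \<phi> [a \<oplus>\<^bsub>L\<^esub> x, b, c] = \<phi> [a, b, c] \<oplus>\<^bsub>N\<^esub> \<phi> [x, b, c]"
      "\<And>a b c x. \<lbrakk>a \<in> carrier L; b \<in> carrier L; c \<in> carrier L; x \<in> carrier L\<rbrakk>
        \<Longrightarrow> \<phi> [a, b \<oplus>\<^bsub>L\<^esub> x, c] = \<phi> [a, b, c] \<oplus>\<^bsub>N\<^esub> \<phi> [a, x, c]"
      "\<And>a b c x. \<lbrakk>a \<in> carrier L; b \<in> carrier L; c \<in> carrier L; x \<in> carrier L\<rbrakk>
        \<Longrightarrow> \<phi> [a, b, c \<oplus>\<^bsub>L\<^esub> x] = \<phi> [a, b, c] \<oplus>\<^bsub>N\<^esub> \<phi> [a, b, x]"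
    and smult: "\<And>a b c k. \<lbrakk>a \<in> carrier L; b \<in> carrier L; c \<in> carrier L; k \<in> carrier K\<rbrakk>
        \<Longrightarrow> \<phi> [k \<odot>\<^bsub>L\<^esub> a, b, c] = k \<odot>\<^bsub>N\<^esub> \<phi> [a, b, c]"
      "\<And>a b c k. \<lbrakk>a \<in> carrier L; b \<in> carrier L; c \<in> carrier L; k \<in> carrier K\<rbrakk>
        \<Longrightarrow> \<phi> [a, k \<odot>\<^bsub>L\<^esub> b, c] = k \<odot>\<^bsub>N\<^esub> \<phi> [a, b, c]"
      "\<And>a b c k. \<lbrakk>a \<in> carrier L; b \<in> carrier L; c \<in> carrier L; k \<in> carrier K\<rbrakk>
        \<Longrightarrow> \<phi> [a, b, k \<odot>\<^bsub>L\<^esub> c] = k \<odot>\<^bsub>N\<^esub> \<phi> [a, b, c]"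
  shows "multilinear K L N 3 \<phi>"
proof -
  have xs: "\<exists>a b c. xs = [a, b, c] \<and> {a, b, c} \<subseteq> carrier L" if "xs \<in> tuples L 3" for xs
    using that by (auto simp: tuples_explicit)
  show ?thesis
    unfolding multilinear_def
  proof (intro conjI ballI allI impI)
    fix xs assume "xs \<in> tuples L 3"
    from xs[OF this] closed show "\<phi> xs \<in> carrier N" by auto
  next
    fix xs x y and i :: nat assume *: "xs \<in> tuples L 3" "i < 3" "x \<in> carrier L" "y \<in> carrier L"
    consider "i = 0" | "i = 1" | "i = 2" using *(2) by linarith
    then show "\<phi> (xs[i := x \<oplus>\<^bsub>L\<^esub> y]) = \<phi> (xs[i := x]) \<oplus>\<^bsub>N\<^esub> \<phi> (xs[i := y])"
      using xs[OF *(1)] *(3,4) add by cases (auto simp: numeral_nat)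
  next
    fix xs k x and i :: nat assume *: "xs \<in> tuples L 3" "i < 3" "x \<in> carrier L" "k \<in> carrier K"
    consider "i = 0" | "i = 1" | "i = 2" using *(2) by linarith
    then show "\<phi> (xs[i := k \<odot>\<^bsub>L\<^esub> x]) = k \<odot>\<^bsub>N\<^esub> \<phi> (xs[i := x])"
      using xs[OF *(1)] *(3,4) smult by cases (auto simp: numeral_nat)
  qed
qed

lemma multilinear_3D:
  assumes "multilinear K L N 3 \<phi>" "a \<in> carrier L" "b \<in> carrier L" "c \<in> carrier L"
  shows "\<phi> [a, b, c] \<in> carrier N"
    and "x \<in> carrier L \<Longrightarrow> \<phi> [a \<oplus>\<^bsub>L\<^esub> x, b, c] = \<phi> [a, b, c] \<oplus>\<^bsub>N\<^esub> \<phi> [x, b, c]"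
    and "x \<in> carrier L \<Longrightarrow> \<phi> [a, b \<oplus>\<^bsub>L\<^esub> x, c] = \<phi> [a, b, c] \<oplus>\<^bsub>N\<^esub> \<phi> [a, x, c]"
    and "x \<in> carrier L \<Longrightarrow> \<phi> [a, b, c \<oplus>\<^bsub>L\<^esub> x] = \<phi> [a, b, c] \<oplus>\<^bsub>N\<^esub> \<phi> [a, b, x]"
    and "k \<in> carrier K \<Longrightarrow> \<phi> [k \<odot>\<^bsub>L\<^esub> a, b, c] = k \<odot>\<^bsub>N\<^esub> \<phi> [a, b, c]"
    and "k \<in> carrier K \<Longrightarrow> \<phi> [a, k \<odot>\<^bsub>L\<^esub> b, c] = k \<odot>\<^bsub>N\<^esub> \<phi> [a, b, c]"
    and "k \<in> carrier K \<Longrightarrow> \<phi> [a, b, k \<odot>\<^bsub>L\<^esub> c] = k \<odot>\<^bsub>N\<^esub> \<phi> [a, b, c]"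
proof -
  have t: "[a, b, c] \<in> tuples L 3" using assms by (simp add: tuples_def)
  show "\<phi> [a, b, c] \<in> carrier N" using assms(1) t by (simp add: multilinear_def)
  note mul = assms(1)[unfolded multilinear_def, THEN conjunct2, rule_format, OF t]
  show "\<phi> [a \<oplus>\<^bsub>L\<^esub> x, b, c] = \<phi> [a, b, c] \<oplus>\<^bsub>N\<^esub> \<phi> [x, b, c]" if "x \<in> carrier L"
    using mul[of 0 a, THEN conjunct1] that assms by (simp add: numeral_nat)
  show "\<phi> [a, b \<oplus>\<^bsub>L\<^esub> x, c] = \<phi> [a, b, c] \<oplus>\<^bsub>N\<^esub> \<phi> [a, x, c]" if "x \<in> carrier L"
    using mul[of 1 b, THEN conjunct1] that assms by (simp add: numeral_nat)
  show "\<phi> [a, b, c \<oplus>\<^bsub>L\<^esub> x] = \<phi> [a, b, c] \<oplus>\<^bsub>N\<^esub> \<phi> [a, b, x]" if "x \<in> carrier L"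
    using mul[of 2 c, THEN conjunct1] that assms by (simp add: numeral_nat)
  show "\<phi> [k \<odot>\<^bsub>L\<^esub> a, b, c] = k \<odot>\<^bsub>N\<^esub> \<phi> [a, b, c]" if "k \<in> carrier K"
    using mul[of 0 a, THEN conjunct2] that assms by (simp add: numeral_nat)
  show "\<phi> [a, k \<odot>\<^bsub>L\<^esub> b, c] = k \<odot>\<^bsub>N\<^esub> \<phi> [a, b, c]" if "k \<in> carrier K"
    using mul[of 1 b, THEN conjunct2] that assms by (simp add: numeral_nat)
  show "\<phi> [a, b, k \<odot>\<^bsub>L\<^esub> c] = k \<odot>\<^bsub>N\<^esub> \<phi> [a, b, c]" if "k \<in> carrier K"
    using mul[of 2 c, THEN conjunct2] that assms by (simp add: numeral_nat)
qed

lemma multilinear_4I: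
  assumes closed: "\<And>a b c d. \<lbrakk>a \<in> carrier L; b \<in> carrier L; c \<in> carrier L; d \<in> carrier L\<rbrakk> \<Longrightarrow> \<phi> [a, b, c, d] \<in> carrier N"
    and add: "\<And>a b c d x. \<lbrakk>a \<in> carrier L; b \<in> carrier L; c \<in> carrier L; d \<in> carrier L; x \<in> carrier L\<rbrakk>
        \<Longrightarrow> \<phi> [a \<oplus>\<^bsub>L\<^esub> x, b, c, d] = \<phi> [a, b, c, d] \<oplus>\<^bsub>N\<^esub> \<phi> [x, b, c, d]"
      "\<And>a b c d x. \<lbrakk>a \<in> carrier L; b \<in> carrier L; c \<in> carrier L; d \<in> carrier L; x \<in> carrier L\<rbrakk>
        \<Longrightarrow> \<phi> [a, b \<oplus>\<^bsub>L\<^esub> x, c, d] = \<phi> [a, b, c, d] \<oplus>\<^bsub>N\<^esub> \<phi> [a, x, c, d]"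
      "\<And>a b c d x. \<lbrakk>a \<in> carrier L; b \<in> carrier L; c \<in> carrier L; d \<in> carrier L; x \<in> carrier L\<rbrakk>
        \<Longrightarrow> \<phi> [a, b, c \<oplus>\<^bsub>L\<^esub> x, d] = \<phi> [a, b, c, d] \<oplus>\<^bsub>N\<^esub> \<phi> [a, b, x, d]"
      "\<And>a b c d x. \<lbrakk>a \<in> carrier L; b \<in> carrier L; c \<in> carrier L; d \<in> carrier L; x \<in> carrier L\<rbrakk>
        \<Longrightarrow> \<phi> [a, b, c, d \<oplus>\<^bsub>L\<^esub> x] = \<phi> [a, b, c, d] \<oplus>\<^bsub>N\<^esub> \<phi> [a, b, c, x]"
    and smult: "\<And>a b c d k. \<lbrakk>a \<in> carrier L; b \<in> carrier L; c \<in> carrier L; d \<in> carrier L; k \<in> carrier K\<rbrakk>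
        \<Longrightarrow> \<phi> [k \<odot>\<^bsub>L\<^esub> a, b, c, d] = k \<odot>\<^bsub>N\<^esub> \<phi> [a, b, c, d]"
      "\<And>a b c d k. \<lbrakk>a \<in> carrier L; b \<in> carrier L; c \<in> carrier L; d \<in> carrier L; k \<in> carrier K\<rbrakk>
        \<Longrightarrow> \<phi> [a, k \<odot>\<^bsub>L\<^esub> b, c, d] = k \<odot>\<^bsub>N\<^esub> \<phi> [a, b, c, d]"
      "\<And>a b c d k. \<lbrakk>a \<in> carrier L; b \<in> carrier L; c \<in> carrier L; d \<in> carrier L; k \<in> carrier K\<rbrakk>
        \<Longrightarrow> \<phi> [a, b, k \<odot>\<^bsub>L\<^esub> c, d] = k \<odot>\<^bsub>N\<^esub> \<phi> [a, b, c, d]"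
      "\<And>a b c d k. \<lbrakk>a \<in> carrier L; b \<in> carrier L; c \<in> carrier L; d \<in> carrier L; k \<in> carrier K\<rbrakk>
        \<Longrightarrow> \<phi> [a, b, c, k \<odot>\<^bsub>L\<^esub> d] = k \<odot>\<^bsub>N\<^esub> \<phi> [a, b, c, d]"
  shows "multilinear K L N 4 \<phi>"
proof -
  have xs: "\<exists>a b c d. xs = [a, b, c, d] \<and> {a, b, c, d} \<subseteq> carrier L" if "xs \<in> tuples L 4" for xs
    using that by (auto simp: tuples_explicit)
  show ?thesis
    unfolding multilinear_def
  proof (intro conjI ballI allI impI)
    fix xs assume "xs \<in> tuples L 4"
    from xs[OF this] closed show "\<phi> xs \<in> carrier N" by auto
  next
    fix xs x y and i :: nat assume *: "xs \<in> tuples L 4" "i < 4" "x \<in> carrier L" "y \<in> carrier L"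
    consider "i = 0" | "i = 1" | "i = 2" | "i = 3" using *(2) by linarith
    then show "\<phi> (xs[i := x \<oplus>\<^bsub>L\<^esub> y]) = \<phi> (xs[i := x]) \<oplus>\<^bsub>N\<^esub> \<phi> (xs[i := y])"
      using xs[OF *(1)] *(3,4) add by cases (auto simp: numeral_nat)
  next
    fix xs k x and i :: nat assume *: "xs \<in> tuples L 4" "i < 4" "x \<in> carrier L" "k \<in> carrier K"
    consider "i = 0" | "i = 1" | "i = 2" | "i = 3" using *(2) by linarith
    then show "\<phi> (xs[i := k \<odot>\<^bsub>L\<^esub> x]) = k \<odot>\<^bsub>N\<^esub> \<phi> (xs[i := x])"
      using xs[OF *(1)] *(3,4) smult by cases (auto simp: numeral_nat)
  qed
qed

lemma tuples_3E:
  assumes "xs \<in> tuples L 3"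
  obtains a b c where "xs = [a, b, c]" "a \<in> carrier L" "b \<in> carrier L" "c \<in> carrier L"
  using assms by (auto simp: tuples_explicit)

lemma tuples_4E:
  assumes "xs \<in> tuples L 4"
  obtains a b c d where "xs = [a, b, c, d]"
    "a \<in> carrier L" "b \<in> carrier L" "c \<in> carrier L" "d \<in> carrier L"
  using assms by (auto simp: tuples_explicit)

section \<open>The boundary and Koszul maps on generators\<close>

context lie_algebra
begin

declare bracket_closed [simp, intro] bracket_self [simp]

lemma bracket_zero_left [simp]: "x \<in> carrier L \<Longrightarrow> bracket L \<zero>\<^bsub>L\<^esub> x = \<zero>\<^bsub>L\<^esub>"
  using bracket_smult_left[of "\<zero>\<^bsub>K\<^esub>" "\<zero>\<^bsub>L\<^esub>" x] by simp

lemma bracket_zero_right [simp]: "x \<in> carrier L \<Longrightarrow> bracket L x \<zero>\<^bsub>L\<^esub> = \<zero>\<^bsub>L\<^esub>"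
  using bracket_smult_right[of "\<zero>\<^bsub>K\<^esub>" x "\<zero>\<^bsub>L\<^esub>"] by simp

text \<open>Polarisation: the bracket of \<open>x \<oplus> y\<close> with itself is zero, and so are
  the two diagonal terms of its expansion. For the expansion \<open>bracket_self\<close> is switched
  off, since it could collapse the left side first.\<close>

lemma bracket_commute:
  assumes "x \<in> carrier L" "y \<in> carrier L"
  shows "bracket L y x = \<ominus>\<^bsub>L\<^esub> bracket L x y"
proof -
  have "bracket L (x \<oplus>\<^bsub>L\<^esub> y) (x \<oplus>\<^bsub>L\<^esub> y) = (bracket L x x \<oplus>\<^bsub>L\<^esub> bracket L y x)
      \<oplus>\<^bsub>L\<^esub> (bracket L x y \<oplus>\<^bsub>L\<^esub> bracket L y y)"
    using assms by (simp add: bracket_add_left bracket_add_right del: bracket_self)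
  then show ?thesis using assms by (simp add: M.minus_equality)
qed

lemma bracket_uminus_right:
  assumes "x \<in> carrier L" "y \<in> carrier L"
  shows "bracket L x (\<ominus>\<^bsub>L\<^esub> y) = \<ominus>\<^bsub>L\<^esub> bracket L x y"
  using bracket_add_right[of x "\<ominus>\<^bsub>L\<^esub> y" y] assms by (simp add: M.l_neg M.minus_equality[symmetric])

lemma bracket_uminus_left:
  assumes "x \<in> carrier L" "y \<in> carrier L"
  shows "bracket L (\<ominus>\<^bsub>L\<^esub> x) y = \<ominus>\<^bsub>L\<^esub> bracket L x y"
  using bracket_add_left[of "\<ominus>\<^bsub>L\<^esub> x" x y] assms by (simp add: M.l_neg M.minus_equality[symmetric])

sublocale ext2: module K "exterior_power K L 2" by (rule exterior_power_module)
sublocale ext3: module K "exterior_power K L 3" by (rule exterior_power_module)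
sublocale sym2: module K "sym_square K L" by (rule sym_square_module)

lemmas multilinear_wedge2 = multilinear_2D[OF multilinear_wedge]
lemmas multilinear_wedge3 = multilinear_3D[OF multilinear_wedge]

lemma wedge2_zero [simp]:
  "x \<in> carrier L \<Longrightarrow> wedge K L [\<zero>\<^bsub>L\<^esub>, x] = \<zero>\<^bsub>exterior_power K L 2\<^esub>"
  using multilinear_wedge2(4)[of "\<zero>\<^bsub>L\<^esub>" x "\<zero>\<^bsub>K\<^esub>"] by (simp add: multilinear_wedge2(1))

lemma wedge3_zero [simp]:
  "\<lbrakk>x \<in> carrier L; y \<in> carrier L\<rbrakk>
    \<Longrightarrow> wedge K L [\<zero>\<^bsub>L\<^esub>, x, y] = \<zero>\<^bsub>exterior_power K L 3\<^esub>"
  using multilinear_wedge3(5)[of "\<zero>\<^bsub>L\<^esub>" x y "\<zero>\<^bsub>K\<^esub>"] by (simp add: multilinear_wedge3(1))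

lemma wedge3_same [simp]:
  "\<lbrakk>w \<in> carrier L; x \<in> carrier L\<rbrakk> \<Longrightarrow> wedge K L [w, x, x] = \<zero>\<^bsub>exterior_power K L 3\<^esub>"
  using wedge_not_distinct[of "[w, x, x]" 3] by (simp add: tuples_def)

lemma wedge2_bracket_commute:
  assumes "x \<in> carrier L" "y \<in> carrier L" "z \<in> carrier L"
  shows "wedge K L [bracket L y x, z] = \<ominus>\<^bsub>exterior_power K L 2\<^esub> wedge K L [bracket L x y, z]"
  using multilinear_wedge2(2)[of "bracket L y x" z "bracket L x y"] assms bracket_commute[of x y]
  by (simp add: multilinear_wedge2(1) M.l_neg ext2.M.minus_equality)

lemma wedge3_bracket_commute:
  assumes "x \<in> carrier L" "y \<in> carrier L" "z \<in> carrier L" "w \<in> carrier L"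
  shows "wedge K L [bracket L y x, z, w] = \<ominus>\<^bsub>exterior_power K L 3\<^esub> wedge K L [bracket L x y, z, w]"
  using multilinear_wedge3(2)[of "bracket L y x" z w "bracket L x y"] assms bracket_commute[of x y]
  by (simp add: multilinear_wedge3(1) M.l_neg ext3.M.minus_equality)

text \<open>Polarisation in the last two slots, from the vanishing on repeated entries.\<close>

lemma wedge3_swap:
  assumes "w \<in> carrier L" "x \<in> carrier L" "y \<in> carrier L"
  shows "wedge K L [w, y, x] = \<ominus>\<^bsub>exterior_power K L 3\<^esub> wedge K L [w, x, y]"
proof -
  let ?P = "exterior_power K L 3"
  have "wedge K L [w, y, x] \<oplus>\<^bsub>?P\<^esub> wedge K L [w, x, y] = wedge K L [w, x \<oplus>\<^bsub>L\<^esub> y, x \<oplus>\<^bsub>L\<^esub> y]"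
    using assms
    \<comment> \<open>Only the instances for \<open>x\<close> and \<open>y\<close> may fire here;
      the general rule could erase the right side before it is expanded.\<close>
    by (simp add: multilinear_wedge3 wedge3_same[of w x] wedge3_same[of w y] del: wedge3_same)
  also have "\<dots> = \<zero>\<^bsub>?P\<^esub>" using assms by simp
  finally show ?thesis using assms by (simp add: multilinear_wedge3 ext3.M.minus_equality)
qed

text \<open>The value of the boundary on a generator of the exterior power, named so that
  multilinearity and alternation, on which the meaning of \<open>ce_boundary\<close> rests, can be
  stated for it.\<close>

definition "ce_terms n xs = (\<Oplus>\<^bsub>exterior_power K L (n - 1)\<^esub>p\<in>{(i, j). i < j \<and> j < length xs}.
          case p of (i, j) \<Rightarrow>
            ((\<ominus>\<^bsub>K\<^esub> \<one>\<^bsub>K\<^esub>) [^]\<^bsub>K\<^esub> (i + j)) \<odot>\<^bsub>exterior_power K L (n - 1)\<^esub>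
              wedge K L (bracket L (xs ! i) (xs ! j) # nths xs (- {i, j})))"

lemma nths_explicit:
  "nths [a, b, c] (- {0, Suc 0}) = [c]" "nths [a, b, c] (- {0, 2}) = [b]"
  "nths [a, b, c] (- {Suc 0, 2}) = [a]"
  "nths [a, b, c, d] (- {0, Suc 0}) = [c, d]" "nths [a, b, c, d] (- {0, 2}) = [b, d]"
  "nths [a, b, c, d] (- {0, 3}) = [b, c]" "nths [a, b, c, d] (- {Suc 0, 2}) = [a, d]"
  "nths [a, b, c, d] (- {Suc 0, 3}) = [a, c]" "nths [a, b, c, d] (- {2, 3}) = [a, b]"
  by (simp_all add: nths_Cons)

text \<open>The exponents are the sums i + j with 0 \<le> i < j \<le> 3, so they range from 1 to
  5.\<close>

lemma sign_powers:
  "(\<ominus>\<^bsub>K\<^esub> \<one>\<^bsub>K\<^esub>) [^]\<^bsub>K\<^esub> (1::nat) = \<ominus>\<^bsub>K\<^esub> \<one>\<^bsub>K\<^esub>" "(\<ominus>\<^bsub>K\<^esub> \<one>\<^bsub>K\<^esub>) [^]\<^bsub>K\<^esub> (2::nat) = \<one>\<^bsub>K\<^esub>"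
  "(\<ominus>\<^bsub>K\<^esub> \<one>\<^bsub>K\<^esub>) [^]\<^bsub>K\<^esub> (3::nat) = \<ominus>\<^bsub>K\<^esub> \<one>\<^bsub>K\<^esub>" "(\<ominus>\<^bsub>K\<^esub> \<one>\<^bsub>K\<^esub>) [^]\<^bsub>K\<^esub> (4::nat) = \<one>\<^bsub>K\<^esub>"
  "(\<ominus>\<^bsub>K\<^esub> \<one>\<^bsub>K\<^esub>) [^]\<^bsub>K\<^esub> (5::nat) = \<ominus>\<^bsub>K\<^esub> \<one>\<^bsub>K\<^esub>"
  by (simp_all add: eval_nat_numeral R.l_minus)

lemma ce_terms_3:
  assumes "a \<in> carrier L" "b \<in> carrier L" "c \<in> carrier L"
  shows "ce_terms 3 [a, b, c] =
    wedge K L [bracket L a c, b] \<ominus>\<^bsub>exterior_power K L 2\<^esub> wedge K L [bracket L a b, c]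
      \<ominus>\<^bsub>exterior_power K L 2\<^esub> wedge K L [bracket L b c, a]"
proof -
  have I: "{(i, j). i < j \<and> j < length [a, b, c]} = {(0, 1), (0, 2), (1, 2)}" by auto
  have fin: "finsum N f {(0, 1), (0, 2), (1, 2)} = f (0, 1) \<oplus>\<^bsub>N\<^esub> (f (0, 2) \<oplus>\<^bsub>N\<^esub> f (1, 2))"
    if "module K N" "f (0, 1) \<in> carrier N" "f (0, 2) \<in> carrier N" "f (1, 2) \<in> carrier N"
    for N :: "('k, 'c, 'd) module_scheme" and f :: "nat \<times> nat \<Rightarrow> 'c"
  proof -
    interpret N: module K N by fact
    show ?thesis using that by simp
  qed
  show ?thesis
    unfolding ce_terms_def I
    using assms by (subst fin)
      (simp_all add: exterior_power_module nths_explicit multilinear_wedge2 ext2.smult_l_minus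
        sign_powers[simplified] a_minus_def ext2.M.a_ac)
qed

text \<open>The terms are grouped by the three ways to split the four entries into two pairs.
  Complementary pairs carry the same sign, as their positions add up to 0 + 1 + 2 + 3 = 6, an even
  number. The Koszul map later takes equal values on the two terms of a group.\<close>

lemma ce_terms_4:
  assumes "a \<in> carrier L" "b \<in> carrier L" "c \<in> carrier L" "d \<in> carrier L"
  shows "ce_terms 4 [a, b, c, d] =
    (wedge K L [bracket L a c, b, d] \<oplus>\<^bsub>exterior_power K L 3\<^esub> wedge K L [bracket L b d, a, c])
      \<ominus>\<^bsub>exterior_power K L 3\<^esub>
    (wedge K L [bracket L a b, c, d] \<oplus>\<^bsub>exterior_power K L 3\<^esub> wedge K L [bracket L c d, a, b])
      \<ominus>\<^bsub>exterior_power K L 3\<^esub>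
    (wedge K L [bracket L a d, b, c] \<oplus>\<^bsub>exterior_power K L 3\<^esub> wedge K L [bracket L b c, a, d])"
proof -
  let ?I = "{(0, 1), (0, 2), (1, 2), (0, 3), (1, 3), (2, 3)}"
  have I: "{(i, j). i < j \<and> j < length [a, b, c, d]} = ?I" by auto
  have fin: "finsum N f ?I = f (0, 1) \<oplus>\<^bsub>N\<^esub> (f (0, 2) \<oplus>\<^bsub>N\<^esub> (f (1, 2)
      \<oplus>\<^bsub>N\<^esub> (f (0, 3) \<oplus>\<^bsub>N\<^esub> (f (1, 3) \<oplus>\<^bsub>N\<^esub> f (2, 3)))))"
    if "module K N" "f ` ?I \<subseteq> carrier N"
    for N :: "('k, 'c, 'd) module_scheme" and f :: "nat \<times> nat \<Rightarrow> 'c"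
  proof -
    interpret N: module K N by fact
    show ?thesis using that(2) by simp
  qed
  show ?thesis
    unfolding ce_terms_def I
    using assms by (subst fin)
      (simp_all add: exterior_power_module nths_explicit multilinear_wedge3 ext3.smult_l_minus
        sign_powers[simplified] R.l_minus a_minus_def ext3.M.minus_add ext3.M.a_ac)
qed


lemma multilinear_bracket_wedge_3:
  shows "multilinear K L (exterior_power K L 2) 3 (\<lambda>xs. wedge K L [bracket L (xs ! 0) (xs ! 1), xs ! 2])"
    and "multilinear K L (exterior_power K L 2) 3 (\<lambda>xs. wedge K L [bracket L (xs ! 0) (xs ! 2), xs ! 1])"
    and "multilinear K L (exterior_power K L 2) 3 (\<lambda>xs. wedge K L [bracket L (xs ! 1) (xs ! 2), xs ! 0])"
  by (rule multilinear_3I;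
      simp add: bracket_add_left bracket_add_right bracket_smult_left bracket_smult_right multilinear_wedge2)+

lemma multilinear_ce_terms_3: "multilinear K L (exterior_power K L 2) 3 (ce_terms 3)"
proof (rule multilinear_cong)
  show "multilinear K L (exterior_power K L 2) 3
    (\<lambda>xs. wedge K L [bracket L (xs ! 0) (xs ! 2), xs ! 1]
      \<ominus>\<^bsub>exterior_power K L 2\<^esub> wedge K L [bracket L (xs ! 0) (xs ! 1), xs ! 2]
      \<ominus>\<^bsub>exterior_power K L 2\<^esub> wedge K L [bracket L (xs ! 1) (xs ! 2), xs ! 0])"
    by (intro multilinear_minus multilinear_bracket_wedge_3 exterior_power_module)
qed (auto elim!: tuples_3E simp: ce_terms_3)

text \<open>If neighbouring entries agree, one bracket is zero and the other two terms cancel as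
  they stand. If the outer entries agree, the two surviving terms have equal signs and cancel by
  antisymmetry of the bracket.\<close>

lemma ce_terms_3_not_distinct:
  assumes "xs \<in> tuples L 3" "\<not> distinct xs"
  shows "ce_terms 3 xs = \<zero>\<^bsub>exterior_power K L 2\<^esub>"
proof -
  obtain a b c where xs: "xs = [a, b, c]" and L: "a \<in> carrier L" "b \<in> carrier L" "c \<in> carrier L"
    using assms(1) by (elim tuples_3E)
  note simps = xs L ce_terms_3 multilinear_wedge2(1) ext2.M.minus_eq ext2.M.r_neg ext2.M.l_neg
  consider "a = b" | "a = c" | "b = c" using assms(2) xs by auto
  then show ?thesis
  proof cases
    case 1
    with L show ?thesis by (simp add: simps)
  next
    case 2
    with L show ?thesis by (simp add: simps wedge2_bracket_commute[of c b])
  next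
    case 3
    with L show ?thesis by (simp add: simps)
  qed
qed

lemma multilinear_bracket_wedge_4:
  shows "multilinear K L (exterior_power K L 3) 4 (\<lambda>xs. wedge K L [bracket L (xs ! 0) (xs ! 1), xs ! 2, xs ! 3])"
    and "multilinear K L (exterior_power K L 3) 4 (\<lambda>xs. wedge K L [bracket L (xs ! 0) (xs ! 2), xs ! 1, xs ! 3])"
    and "multilinear K L (exterior_power K L 3) 4 (\<lambda>xs. wedge K L [bracket L (xs ! 0) (xs ! 3), xs ! 1, xs ! 2])"
    and "multilinear K L (exterior_power K L 3) 4 (\<lambda>xs. wedge K L [bracket L (xs ! 1) (xs ! 2), xs ! 0, xs ! 3])"
    and "multilinear K L (exterior_power K L 3) 4 (\<lambda>xs. wedge K L [bracket L (xs ! 1) (xs ! 3), xs ! 0, xs ! 2])"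
    and "multilinear K L (exterior_power K L 3) 4 (\<lambda>xs. wedge K L [bracket L (xs ! 2) (xs ! 3), xs ! 0, xs ! 1])"
  by (rule multilinear_4I;
      simp add: bracket_add_left bracket_add_right bracket_smult_left bracket_smult_right multilinear_wedge3)+

lemma multilinear_ce_terms_4: "multilinear K L (exterior_power K L 3) 4 (ce_terms 4)"
proof (rule multilinear_cong)
  show "multilinear K L (exterior_power K L 3) 4
    (\<lambda>xs. (wedge K L [bracket L (xs ! 0) (xs ! 2), xs ! 1, xs ! 3]
        \<oplus>\<^bsub>exterior_power K L 3\<^esub> wedge K L [bracket L (xs ! 1) (xs ! 3), xs ! 0, xs ! 2])
      \<ominus>\<^bsub>exterior_power K L 3\<^esub> (wedge K L [bracket L (xs ! 0) (xs ! 1), xs ! 2, xs ! 3]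
        \<oplus>\<^bsub>exterior_power K L 3\<^esub> wedge K L [bracket L (xs ! 2) (xs ! 3), xs ! 0, xs ! 1])
      \<ominus>\<^bsub>exterior_power K L 3\<^esub> (wedge K L [bracket L (xs ! 0) (xs ! 3), xs ! 1, xs ! 2]
        \<oplus>\<^bsub>exterior_power K L 3\<^esub> wedge K L [bracket L (xs ! 1) (xs ! 2), xs ! 0, xs ! 3]))"
    by (intro multilinear_minus multilinear_add multilinear_bracket_wedge_4 exterior_power_module)
qed (auto elim!: tuples_4E simp: ce_terms_4)

text \<open>Two equal entries kill the whole group in which they are paired: their bracket is zero,
  and the complementary wedge has a repeated entry. The other two groups cancel each other, up to
  antisymmetry of the bracket and swaps in the wedge.\<close>

lemma ce_terms_4_not_distinct:
  assumes "xs \<in> tuples L 4" "\<not> distinct xs"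
  shows "ce_terms 4 xs = \<zero>\<^bsub>exterior_power K L 3\<^esub>"
proof -
  obtain a b c d where xs: "xs = [a, b, c, d]"
    and L: "a \<in> carrier L" "b \<in> carrier L" "c \<in> carrier L" "d \<in> carrier L"
    using assms(1) by (elim tuples_4E)
  note simps = xs L ce_terms_4 multilinear_wedge3(1) ext3.M.minus_eq ext3.M.r_neg ext3.M.l_neg
    ext3.M.a_comm
  consider "a = b" | "a = c" | "a = d" | "b = c" | "b = d" | "c = d" using assms(2) xs by auto
  then show ?thesis
  proof cases
    case 1
    with L show ?thesis by (simp add: simps)
  next
    case 2
    with L show ?thesis
      by (simp add: simps ext3.M.minus_add[symmetric] wedge3_bracket_commute[of c b]
          wedge3_swap[of _ c b])
  next
    case 3
    with L show ?thesis
      by (simp add: simps wedge3_bracket_commute[of d b] wedge3_bracket_commute[of d c]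
          wedge3_swap[of _ d b] wedge3_swap[of _ d c])
  next
    case 4
    with L show ?thesis by (simp add: simps)
  next
    case 5
    with L show ?thesis
      by (simp add: simps ext3.M.minus_add[symmetric] wedge3_bracket_commute[of d c]
          wedge3_swap[of _ d c])
  next
    case 6
    with L show ?thesis by (simp add: simps)
  qed
qed

end

context module
begin

lemma linear_map_tensor_eqI:
  assumes "linear_map R (tensor_power R M n) N f" "linear_map R (tensor_power R M n) N g"
    and "\<And>xs. xs \<in> tuples M n \<Longrightarrow>
      f (presented_gen R (tuples M n) (multilinear_rels R M n) xs)
        = g (presented_gen R (tuples M n) (multilinear_rels R M n) xs)"
    and "h \<in> carrier (tensor_power R M n)"
  shows "f h = g h"
  by (rule linear_map_presented_eqI[OF multilinear_rels_closed assms(1)[unfolded tensor_power_def]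
        assms(2)[unfolded tensor_power_def] assms(3) assms(4)[unfolded tensor_power_def]])

lemma linear_map_zero:
  assumes "module R N" shows "linear_map R M N (\<lambda>_. \<zero>\<^bsub>N\<^esub>)"
proof -
  interpret N: module R N by fact
  show ?thesis by (rule linear_mapI) (simp_all add: module_axioms assms)
qed

lemma tensor_power_module: "module R (tensor_power R M n)"
  unfolding tensor_power_def by (rule presented_module_module[OF multilinear_rels_closed])

lemma tensor_gen_closed: "xs \<in> tuples M n \<Longrightarrow>
    presented_gen R (tuples M n) (multilinear_rels R M n) xs \<in> carrier (tensor_power R M n)"
  unfolding tensor_power_def by (rule presented_gen_closed[OF multilinear_rels_closed])

end

section \<open>The Killing module, the Koszul map and the reduction from homology to cycles\<close>

context lie_algebra
begin

text \<open>The universal invariant symmetric bilinear form of \<open>L\<close>. Statements about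
  radicals are made for this form.\<close>

definition kill_prod where
  "kill_prod x y = killing_rels K L +>\<^bsub>sym_square K L\<^esub> sym_prod K L x y"

lemma multilinear_sym:
  assumes "x \<in> carrier L" "y \<in> carrier L"
  shows "sym_prod K L x y \<in> carrier (sym_square K L)"
    and "z \<in> carrier L \<Longrightarrow>
      sym_prod K L (x \<oplus>\<^bsub>L\<^esub> z) y = sym_prod K L x y \<oplus>\<^bsub>sym_square K L\<^esub> sym_prod K L z y"
    and "z \<in> carrier L \<Longrightarrow>
      sym_prod K L x (y \<oplus>\<^bsub>L\<^esub> z) = sym_prod K L x y \<oplus>\<^bsub>sym_square K L\<^esub> sym_prod K L x z"
    and "c \<in> carrier K \<Longrightarrow>
      sym_prod K L (c \<odot>\<^bsub>L\<^esub> x) y = c \<odot>\<^bsub>sym_square K L\<^esub> sym_prod K L x y"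
    and "c \<in> carrier K \<Longrightarrow>
      sym_prod K L x (c \<odot>\<^bsub>L\<^esub> y) = c \<odot>\<^bsub>sym_square K L\<^esub> sym_prod K L x y"
  using multilinear_2D[OF multilinear_sym_prod assms, simplified] by auto

lemma multilinear_killing:
  "multilinear K L (sym_square K L) 3
    (\<lambda>xs. sym_prod K L (bracket L (xs ! 0) (xs ! 1)) (xs ! 2)
      \<ominus>\<^bsub>sym_square K L\<^esub> sym_prod K L (xs ! 0) (bracket L (xs ! 1) (xs ! 2)))"
proof (rule multilinear_minus[OF sym_square_module])
  show "multilinear K L (sym_square K L) 3
      (\<lambda>xs. sym_prod K L (bracket L (xs ! 0) (xs ! 1)) (xs ! 2))"
    "multilinear K L (sym_square K L) 3
      (\<lambda>xs. sym_prod K L (xs ! 0) (bracket L (xs ! 1) (xs ! 2)))"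
    by (rule multilinear_3I; simp add: multilinear_sym bracket_add_left bracket_add_right
        bracket_smult_left bracket_smult_right)+
qed

lemma linear_map_killing: "linear_map K (tensor_power K L 3) (sym_square K L) (killing_map K L)"
  unfolding killing_map_def by (rule linear_map_tensor[OF sym_square_module multilinear_killing])

lemma killing_map_gen:
  assumes "a \<in> carrier L" "b \<in> carrier L" "c \<in> carrier L"
  shows "killing_map K L (presented_gen K (tuples L 3) (multilinear_rels K L 3) [a, b, c])
    = sym_prod K L (bracket L a b) c \<ominus>\<^bsub>sym_square K L\<^esub> sym_prod K L a (bracket L b c)"
  unfolding killing_map_def
  using linear_ext_tensor[OF sym_square_module multilinear_killing, of "[a, b, c]"] assms
  by (simp add: tuples_def)

lemma submodule_killing_rels: "submodule (killing_rels K L) K (sym_square K L)"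
  unfolding killing_rels_def
  by (rule linear_map.submodule_image[OF linear_map_killing module.carrier_is_submodule[OF tensor_power_module]])

lemma killing_module_module: "module K (killing_module K L)"
  unfolding killing_module_def by (rule sym2.quot_module_module[OF submodule_killing_rels])

sublocale kill: module K "killing_module K L" by (rule killing_module_module)

lemma linear_map_killing_coset: "linear_map K (sym_square K L) (killing_module K L)
    (\<lambda>s. killing_rels K L +>\<^bsub>sym_square K L\<^esub> s)"
  unfolding killing_module_def by (rule sym2.linear_map_coset[OF submodule_killing_rels])

lemma kill_prod_simps:
  assumes "x \<in> carrier L" "y \<in> carrier L"
  shows kill_prod_closed: "kill_prod x y \<in> carrier (killing_module K L)"
    and kill_prod_add_left: "z \<in> carrier L \<Longrightarrow>
      kill_prod (x \<oplus>\<^bsub>L\<^esub> z) y = kill_prod x y \<oplus>\<^bsub>killing_module K L\<^esub> kill_prod z y"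
    and kill_prod_add_right: "z \<in> carrier L \<Longrightarrow>
      kill_prod x (y \<oplus>\<^bsub>L\<^esub> z) = kill_prod x y \<oplus>\<^bsub>killing_module K L\<^esub> kill_prod x z"
    and kill_prod_smult_left: "c \<in> carrier K \<Longrightarrow>
      kill_prod (c \<odot>\<^bsub>L\<^esub> x) y = c \<odot>\<^bsub>killing_module K L\<^esub> kill_prod x y"
    and kill_prod_smult_right: "c \<in> carrier K \<Longrightarrow>
      kill_prod x (c \<odot>\<^bsub>L\<^esub> y) = c \<odot>\<^bsub>killing_module K L\<^esub> kill_prod x y"
proof -
  interpret q: linear_map K "sym_square K L" "killing_module K L"
    "\<lambda>s. killing_rels K L +>\<^bsub>sym_square K L\<^esub> s"
    by (rule linear_map_killing_coset)
  note assms [simp]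
  show "kill_prod x y \<in> carrier (killing_module K L)"
    by (simp add: kill_prod_def multilinear_sym)
  show "kill_prod (x \<oplus>\<^bsub>L\<^esub> z) y = kill_prod x y \<oplus>\<^bsub>killing_module K L\<^esub> kill_prod z y"
    "kill_prod x (y \<oplus>\<^bsub>L\<^esub> z) = kill_prod x y \<oplus>\<^bsub>killing_module K L\<^esub> kill_prod x z"
    if "z \<in> carrier L" using that by (simp_all add: kill_prod_def multilinear_sym)
  show "kill_prod (c \<odot>\<^bsub>L\<^esub> x) y = c \<odot>\<^bsub>killing_module K L\<^esub> kill_prod x y"
    "kill_prod x (c \<odot>\<^bsub>L\<^esub> y) = c \<odot>\<^bsub>killing_module K L\<^esub> kill_prod x y"
    if "c \<in> carrier K" using that by (simp_all add: kill_prod_def multilinear_sym)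
qed

lemma kill_prod_commute:
  "\<lbrakk>x \<in> carrier L; y \<in> carrier L\<rbrakk> \<Longrightarrow> kill_prod x y = kill_prod y x"
  by (simp add: kill_prod_def sym_prod_commute[of x y])

text \<open>The difference of the two symmetric products is the value of \<open>killing_map\<close>
  on x \<otimes> y \<otimes> z, hence one of the elements divided out.\<close>

lemma kill_prod_invariant:
  assumes "x \<in> carrier L" "y \<in> carrier L" "z \<in> carrier L"
  shows "kill_prod (bracket L x y) z = kill_prod x (bracket L y z)"
proof -
  have "sym_prod K L (bracket L x y) z \<ominus>\<^bsub>sym_square K L\<^esub> sym_prod K L x (bracket L y z)
      \<in> killing_rels K L"
    unfolding killing_rels_def using killing_map_gen[OF assms] tensor_gen_closed[of "[x, y, z]" 3] assms
    by (intro image_eqI) (auto simp: tuples_def)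
  then show ?thesis
    unfolding kill_prod_def using sym2.coset_eq_iff[OF submodule_killing_rels] assms
    by (simp add: multilinear_sym)
qed

lemma kill_prod_zero_left [simp]:
  "x \<in> carrier L \<Longrightarrow> kill_prod \<zero>\<^bsub>L\<^esub> x = \<zero>\<^bsub>killing_module K L\<^esub>"
  using kill_prod_smult_left[of "\<zero>\<^bsub>L\<^esub>" x "\<zero>\<^bsub>K\<^esub>"] by (simp add: kill_prod_closed)

lemma kill_prod_zero_right [simp]:
  "x \<in> carrier L \<Longrightarrow> kill_prod x \<zero>\<^bsub>L\<^esub> = \<zero>\<^bsub>killing_module K L\<^esub>"
  using kill_prod_smult_right[of x "\<zero>\<^bsub>L\<^esub>" "\<zero>\<^bsub>K\<^esub>"] by (simp add: kill_prod_closed)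

lemma kill_prod_uminus_right:
  assumes "x \<in> carrier L" "y \<in> carrier L"
  shows "kill_prod x (\<ominus>\<^bsub>L\<^esub> y) = \<ominus>\<^bsub>killing_module K L\<^esub> kill_prod x y"
  using kill_prod_add_right[of x "\<ominus>\<^bsub>L\<^esub> y" y] assms
  by (simp add: kill_prod_closed M.l_neg kill.M.minus_equality)

text \<open>Degree 3 determines the cycles and degree 4 the boundaries in the exterior cube. In
  both, \<open>ce_boundary\<close> is the linear extension of \<open>ce_terms\<close>, so the
  universal property of the exterior power applies.\<close>

lemma
  shows linear_map_boundary_3: "linear_map K (exterior_power K L 3) (exterior_power K L 2) (ce_boundary K L 3)"
    and ce_boundary_wedge_3: "\<And>xs. xs \<in> tuples L 3 \<Longrightarrow> ce_boundary K L 3 (wedge K L xs) = ce_terms 3 xs"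
    and linear_map_boundary_4: "linear_map K (exterior_power K L 4) (exterior_power K L 3) (ce_boundary K L 4)"
    and ce_boundary_wedge_4: "\<And>xs. xs \<in> tuples L 4 \<Longrightarrow> ce_boundary K L 4 (wedge K L xs) = ce_terms 4 xs"
proof -
  have *: "ce_boundary K L n = linear_ext K (exterior_power K L (n - 1)) (ce_terms n)" for n
    by (simp add: ce_boundary_def ce_terms_def[abs_def])
  note 3 = exterior_power_module multilinear_ce_terms_3 ce_terms_3_not_distinct
  show "linear_map K (exterior_power K L 3) (exterior_power K L 2) (ce_boundary K L 3)"
    using linear_map_exterior[OF 3] by (simp add: *)
  show "ce_boundary K L 3 (wedge K L xs) = ce_terms 3 xs" if "xs \<in> tuples L 3" for xs
    using linear_ext_wedge[OF 3] that by (simp add: *)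
  note 4 = exterior_power_module multilinear_ce_terms_4 ce_terms_4_not_distinct
  show "linear_map K (exterior_power K L 4) (exterior_power K L 3) (ce_boundary K L 4)"
    using linear_map_exterior[OF 4] by (simp add: *)
  show "ce_boundary K L 4 (wedge K L xs) = ce_terms 4 xs" if "xs \<in> tuples L 4" for xs
    using linear_ext_wedge[OF 4] that by (simp add: *)
qed

text \<open>Invariance is what makes the Koszul formula alternating: x \<odot> [x, y] = [x, x]
  \<odot> y = 0 in the Killing module. Equal outer entries reduce to this by antisymmetry, and equal
  last entries give a zero bracket.\<close>

lemma
  shows linear_map_koszul: "linear_map K (exterior_power K L 3) (killing_module K L) (koszul_map K L)"
    and koszul_map_wedge: "\<And>a b c. \<lbrakk>a \<in> carrier L; b \<in> carrier L; c \<in> carrier L\<rbrakk>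
      \<Longrightarrow> koszul_map K L (wedge K L [a, b, c]) = kill_prod a (bracket L b c)"
proof -
  let ?\<phi> = "\<lambda>xs. kill_prod (xs ! 0) (bracket L (xs ! 1) (xs ! 2))"
  have mul: "multilinear K L (killing_module K L) 3 ?\<phi>"
    by (rule multilinear_3I; simp add: kill_prod_simps bracket_add_left bracket_add_right
        bracket_smult_left bracket_smult_right)
  have alt: "?\<phi> xs = \<zero>\<^bsub>killing_module K L\<^esub>" if xs3: "xs \<in> tuples L 3" and dup: "\<not> distinct xs" for xs
  proof -
    from xs3 obtain a b c where xs: "xs = [a, b, c]"
      and L: "a \<in> carrier L" "b \<in> carrier L" "c \<in> carrier L"
      by (elim tuples_3E)
    consider "a = b" | "a = c" | "b = c" using dup xs by auto
    then show ?thesis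
    proof cases
      case 1
      then show ?thesis using xs L kill_prod_invariant[of b b c] by simp
    next
      case 2
      have "kill_prod c (bracket L c b) = \<zero>\<^bsub>killing_module K L\<^esub>"
        using L kill_prod_invariant[of c c b] by simp
      then show ?thesis using 2 xs L bracket_commute[of c b] by (simp add: kill_prod_uminus_right)
    qed (simp add: xs L)
  qed
  have *: "koszul_map K L = linear_ext K (killing_module K L) ?\<phi>"
    by (simp add: koszul_map_def kill_prod_def)
  show "linear_map K (exterior_power K L 3) (killing_module K L) (koszul_map K L)"
    unfolding * by (rule linear_map_exterior[OF killing_module_module mul alt])
  show "koszul_map K L (wedge K L [a, b, c]) = kill_prod a (bracket L b c)"
    if "a \<in> carrier L" "b \<in> carrier L" "c \<in> carrier L" for a b c
    unfolding * using linear_ext_wedge[OF killing_module_module mul alt, of "[a, b, c]"] that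
    by (simp add: tuples_def)
qed

text \<open>The six terms of \<open>\<eta> (\<partial> (a \<and> b \<and> c \<and> d))\<close> pair up, and invariance turns each pair into
  twice a Jacobi summand multiplied by \<open>a\<close>.\<close>

lemma koszul_map_boundary:
  assumes "w \<in> carrier (exterior_power K L 4)"
  shows "koszul_map K L (ce_boundary K L 4 w) = \<zero>\<^bsub>killing_module K L\<^esub>"
proof -
  interpret k: linear_map K "exterior_power K L 3" "killing_module K L" "koszul_map K L"
    by (rule linear_map_koszul)
  show ?thesis
  proof (rule linear_map_exterior_eqI[OF linear_map_comp[OF linear_map_boundary_4 linear_map_koszul]
        module.linear_map_zero[OF exterior_power_module killing_module_module] _ assms])
    fix xs assume xs4: "xs \<in> tuples L 4"
    then obtain a b c d where xs: "xs = [a, b, c, d]"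
      and L: "a \<in> carrier L" "b \<in> carrier L" "c \<in> carrier L" "d \<in> carrier L"
      by (elim tuples_4E)
    let ?A = "kill_prod a (bracket L c (bracket L b d))"
    let ?B = "kill_prod a (bracket L b (bracket L c d))"
    let ?C = "kill_prod a (bracket L d (bracket L b c))"
    have inv: "kill_prod (bracket L p q) (bracket L r s) = kill_prod p (bracket L q (bracket L r s))"
      if "p \<in> carrier L" "q \<in> carrier L" "r \<in> carrier L" "s \<in> carrier L" for p q r s
      using that by (simp add: kill_prod_invariant)
    have inv': "kill_prod (bracket L r s) (bracket L p q) = kill_prod p (bracket L q (bracket L r s))"
      if "p \<in> carrier L" "q \<in> carrier L" "r \<in> carrier L" "s \<in> carrier L" for p q r s
      using that inv kill_prod_commute[of "bracket L r s" "bracket L p q"] by simp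
    have "koszul_map K L (ce_terms 4 xs) = (?A \<oplus>\<^bsub>killing_module K L\<^esub> ?A)
        \<ominus>\<^bsub>killing_module K L\<^esub> (?B \<oplus>\<^bsub>killing_module K L\<^esub> ?B)
        \<ominus>\<^bsub>killing_module K L\<^esub> (?C \<oplus>\<^bsub>killing_module K L\<^esub> ?C)"
      using L by (simp add: xs ce_terms_4 multilinear_wedge3(1) koszul_map_wedge
          inv[of a] inv'[of a])
    moreover have "?A = ?B \<oplus>\<^bsub>killing_module K L\<^esub> ?C"
    proof -
      have "bracket L b (bracket L c d) \<oplus>\<^bsub>L\<^esub> bracket L d (bracket L b c)
          \<oplus>\<^bsub>L\<^esub> bracket L c (bracket L d b) = \<zero>\<^bsub>L\<^esub>"
        using jacobi[of b c d] L by (simp add: M.a_ac)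
      moreover have "bracket L c (bracket L b d) = \<ominus>\<^bsub>L\<^esub> bracket L c (bracket L d b)"
        using L by (simp add: bracket_commute[of d b] bracket_uminus_right)
      ultimately have "bracket L c (bracket L b d)
          = bracket L b (bracket L c d) \<oplus>\<^bsub>L\<^esub> bracket L d (bracket L b c)"
        using L by (simp add: M.minus_equality)
      then show ?thesis using L by (simp add: kill_prod_simps)
    qed
    ultimately have "koszul_map K L (ce_terms 4 xs)
        = ((?B \<oplus>\<^bsub>killing_module K L\<^esub> ?B) \<oplus>\<^bsub>killing_module K L\<^esub>
            (?C \<oplus>\<^bsub>killing_module K L\<^esub> ?C))
          \<ominus>\<^bsub>killing_module K L\<^esub> ((?B \<oplus>\<^bsub>killing_module K L\<^esub> ?B)
            \<oplus>\<^bsub>killing_module K L\<^esub> (?C \<oplus>\<^bsub>killing_module K L\<^esub> ?C))"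
      using L by (simp add: kill_prod_closed kill.M.a_ac kill.M.minus_eq kill.M.minus_add)
    then show "koszul_map K L (ce_boundary K L 4 (wedge K L xs)) = \<zero>\<^bsub>killing_module K L\<^esub>"
      using L xs4 by (simp add: ce_boundary_wedge_4 kill_prod_closed)
  qed
qed

text \<open>Because \<eta> vanishes on 3-boundaries, its image of a homology class is a singleton,
  and \<open>the_elem\<close> returns the value at any representing cycle. From here on only cycles
  are considered.\<close>

lemma zero_reduced_koszul_map_iff:
  "zero_reduced_koszul_map K L \<longleftrightarrow>
    (\<forall>z\<in>ce_cycles K L 3. koszul_map K L z = \<zero>\<^bsub>killing_module K L\<^esub>)"
proof -
  interpret k: linear_map K "exterior_power K L 3" "killing_module K L" "koszul_map K L"
    by (rule linear_map_koszul)
  interpret d: linear_map K "exterior_power K L 4" "exterior_power K L 3" "ce_boundary K L 4"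
    by (rule linear_map_boundary_4)
  let ?B = "ce_boundaries K L 3"
  have B: "b \<in> carrier (exterior_power K L 3)" "koszul_map K L b = \<zero>\<^bsub>killing_module K L\<^esub>"
    if "b \<in> ?B" for b
    using that koszul_map_boundary by (auto simp: ce_boundaries_def)
  \<comment> \<open>If there were no boundary, the cosets and their images would be empty and not
    singletons.\<close>
  have "?B \<noteq> {}" using d.M.zero_closed by (auto simp: ce_boundaries_def)
  have red: "reduced_koszul_map K L (?B +>\<^bsub>exterior_power K L 3\<^esub> z) = koszul_map K L z"
    if "z \<in> ce_cycles K L 3" for z
  proof -
    have z: "z \<in> carrier (exterior_power K L 3)" using that by (simp add: ce_cycles_def a_kernel_def')
    have "koszul_map K L ` (?B +>\<^bsub>exterior_power K L 3\<^esub> z) = {koszul_map K L z}"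
      using B z \<open>?B \<noteq> {}\<close> by (auto simp: a_r_coset_def' image_UN)
    then show ?thesis by (simp add: reduced_koszul_map_def)
  qed
  \<comment> \<open>Restricting the carrier to the cycles leaves the addition alone, so the cosets
    are those formed in the whole exterior cube.\<close>
  have "carrier (ce_homology K L 3) = (\<lambda>z. ?B +>\<^bsub>exterior_power K L 3\<^esub> z) ` ce_cycles K L 3"
    by (auto simp: ce_homology_def quot_module_def A_RCOSETS_def' a_r_coset_def')
  then show ?thesis by (simp add: zero_reduced_koszul_map_def red)
qed

end

section \<open>Commutators, homomorphisms and quotients\<close>

context lie_algebra
begin

lemma bracket_mem_commutator:
  "\<lbrakk>x \<in> A; y \<in> B\<rbrakk> \<Longrightarrow> bracket L x y \<in> lie_commutator K L A B"
  unfolding lie_commutator_def by (rule span_incl) auto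

lemma submodule_commutator:
  assumes "A \<subseteq> carrier L" "B \<subseteq> carrier L"
  shows "submodule (lie_commutator K L A B) K L"
  unfolding lie_commutator_def using assms by (intro submodule_span) auto

lemma commutator_closed:
  "\<lbrakk>A \<subseteq> carrier L; B \<subseteq> carrier L\<rbrakk> \<Longrightarrow> lie_commutator K L A B \<subseteq> carrier L"
  using submodule_commutator submoduleE(1) by blast

lemma commutator_mono:
  assumes "A \<subseteq> A'" "B \<subseteq> B'" "A' \<subseteq> carrier L" "B' \<subseteq> carrier L"
  shows "lie_commutator K L A B \<subseteq> lie_commutator K L A' B'"
proof -
  have "{bracket L x y |x y. x \<in> A \<and> y \<in> B} \<subseteq> lie_commutator K L A' B'"
    using assms(1,2) bracket_mem_commutator by blast
  then show ?thesis
    unfolding lie_commutator_def[of K L A B]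
    by (rule span_minimal[OF submodule_commutator[OF assms(3,4)]])
qed

text \<open>For \<open>e\<close> in [g,g], Jacobi writes [e,[x,y]] up to sign as the sum of
  [x,[y,e]] and [y,[e,x]]. Both lie in [g,[g,[g,g]]], the second after turning [e,x] around.\<close>

lemma three_nilpotent_imp_metabelian:
  assumes "three_nilpotent K L"
  shows "metabelian K L"
proof -
  let ?C = "carrier L"
  let ?D = "lie_commutator K L ?C ?C"
  have D: "?D \<subseteq> ?C" by (simp add: commutator_closed)
  have four: "bracket L x (bracket L y e) = \<zero>\<^bsub>L\<^esub>" if "x \<in> ?C" "y \<in> ?C" "e \<in> ?D" for x y e
    using bracket_mem_commutator[OF that(1) bracket_mem_commutator[OF that(2,3)]] assms
    by (simp add: three_nilpotent_def)
  have base: "bracket L e (bracket L x y) = \<zero>\<^bsub>L\<^esub>" if e: "e \<in> ?D" and xy: "x \<in> ?C" "y \<in> ?C" for e x y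
  proof -
    have eC: "e \<in> ?C" using e D by blast
    have "bracket L x (bracket L y e) \<oplus>\<^bsub>L\<^esub> bracket L y (bracket L e x)
        \<oplus>\<^bsub>L\<^esub> bracket L e (bracket L x y) = \<zero>\<^bsub>L\<^esub>"
      using jacobi xy eC by simp
    moreover have "bracket L y (bracket L e x) = \<zero>\<^bsub>L\<^esub>"
      using four[OF xy(2,1) e] xy eC by (simp add: bracket_commute[of x e] bracket_uminus_right)
    ultimately show ?thesis using four[OF xy e] xy eC by simp
  qed
  \<comment> \<open>Brackets only span [g,g]; the elements commuting with all of [g,g] form a
    submodule, so it is enough that they include the brackets.\<close>
  have "submodule {d \<in> ?C. \<forall>e\<in>?D. bracket L e d = \<zero>\<^bsub>L\<^esub>} K L"
    using D by (intro submoduleI)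
      (auto simp: subset_iff bracket_uminus_right bracket_add_right bracket_smult_right)
  then have "?D \<subseteq> {d \<in> ?C. \<forall>e\<in>?D. bracket L e d = \<zero>\<^bsub>L\<^esub>}"
    unfolding lie_commutator_def[of K L ?C ?C]
    by (rule span_minimal) (use base in \<open>auto simp: lie_commutator_def\<close>)
  then show ?thesis by (auto simp: metabelian_def)
qed

text \<open>In a metabelian Lie algebra, [g,g] is orthogonal to [g,[g,g]] for every invariant form, because
  \<open>[x, d] \<odot> e = x \<odot> [d, e] = 0\<close> for \<open>d, e\<close> in [g,g]; one more step of invariance gives the claim.\<close>

lemma kill_prod_metabelian:
  assumes "metabelian K L"
    and n: "n \<in> lie_commutator K L (carrier L)
        (lie_commutator K L (carrier L) (lie_commutator K L (carrier L) (carrier L)))"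
    and x: "x \<in> carrier L"
  shows "kill_prod n x = \<zero>\<^bsub>killing_module K L\<^esub>"
proof -
  let ?C = "carrier L"
  let ?D = "lie_commutator K L ?C ?C"
  let ?G = "lie_commutator K L ?C ?D"
  have D: "?D \<subseteq> ?C" by (simp add: commutator_closed)
  have G: "?G \<subseteq> ?C" by (simp add: commutator_closed D)
  \<comment> \<open>Orthogonal complements are submodules, so orthogonality to a commutator need
    only be checked on the brackets that span it.\<close>
  have sub: "submodule {u \<in> ?C. \<forall>v\<in>V. kill_prod u v = \<zero>\<^bsub>killing_module K L\<^esub>} K L" if "V \<subseteq> ?C" for V
  proof (rule submoduleI)
    fix a assume "a \<in> {u \<in> ?C. \<forall>v\<in>V. kill_prod u v = \<zero>\<^bsub>killing_module K L\<^esub>}"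
    then show "\<ominus>\<^bsub>L\<^esub> a \<in> {u \<in> ?C. \<forall>v\<in>V. kill_prod u v = \<zero>\<^bsub>killing_module K L\<^esub>}"
      using that kill_prod_commute kill_prod_uminus_right by (auto simp: subset_iff)
  qed (use that in \<open>auto simp: subset_iff kill_prod_simps\<close>)
  have GD: "kill_prod y e = \<zero>\<^bsub>killing_module K L\<^esub>" if "y \<in> ?G" "e \<in> ?D" for y e
  proof -
    have "kill_prod (bracket L u d) e = \<zero>\<^bsub>killing_module K L\<^esub>"
      if "u \<in> ?C" "d \<in> ?D" "e \<in> ?D" for u d e
    proof -
      have "bracket L d e = \<zero>\<^bsub>L\<^esub>" using assms(1) that by (simp add: metabelian_def)
      then show ?thesis using that D kill_prod_invariant[of u d e] by (auto simp: subset_iff)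
    qed
    then have "?G \<subseteq> {u \<in> ?C. \<forall>v\<in>?D. kill_prod u v = \<zero>\<^bsub>killing_module K L\<^esub>}"
      unfolding lie_commutator_def[of K L ?C ?D]
      by (intro span_minimal sub D) (use D in \<open>auto simp: subset_iff\<close>)
    then show ?thesis using that by auto
  qed
  have "kill_prod (bracket L u y) v = \<zero>\<^bsub>killing_module K L\<^esub>"
    if "u \<in> ?C" "y \<in> ?G" "v \<in> ?C" for u y v
  proof -
    have y: "y \<in> ?C" using that(2) G by blast
    have "kill_prod (bracket L u y) v = kill_prod (bracket L y v) u"
      using that y kill_prod_invariant[of u y v] kill_prod_commute[of u "bracket L y v"] by simp
    also have "\<dots> = kill_prod y (bracket L v u)" using that y by (simp add: kill_prod_invariant)
    also have "\<dots> = \<zero>\<^bsub>killing_module K L\<^esub>"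
      using that by (intro GD bracket_mem_commutator) auto
    finally show ?thesis .
  qed
  then have "lie_commutator K L ?C ?G
      \<subseteq> {u \<in> ?C. \<forall>v\<in>?C. kill_prod u v = \<zero>\<^bsub>killing_module K L\<^esub>}"
    unfolding lie_commutator_def[of K L ?C ?G]
    by (intro span_minimal sub) (use G in \<open>auto simp: subset_iff\<close>)
  then show ?thesis using n x by auto
qed

end

section \<open>Maps induced by a homomorphism of Lie algebras\<close>

locale lie_hom = L: lie_algebra K L + Q: lie_algebra K Q + linear_map K L Q p
  for K :: "('k, 'm) ring_scheme" and L :: "('k, 'a, 'n) lie_structure_scheme"
    and Q :: "('k, 'b, 'p) lie_structure_scheme" and p +
  assumes map_bracket:
    "\<lbrakk>x \<in> carrier L; y \<in> carrier L\<rbrakk> \<Longrightarrow> p (bracket L x y) = bracket Q (p x) (p y)"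
begin

text \<open>The image of a commutator is a submodule and contains all brackets of images. Hypotheses
  and conclusion are inclusions of the same shape, so the lemma can be nested along the lower
  central series.\<close>

lemma commutator_subset_image:
  assumes "A' \<subseteq> p ` A" "B' \<subseteq> p ` B" "A \<subseteq> carrier L" "B \<subseteq> carrier L"
  shows "lie_commutator K Q A' B' \<subseteq> p ` lie_commutator K L A B"
proof -
  have "{bracket Q x y |x y. x \<in> A' \<and> y \<in> B'} \<subseteq> p ` lie_commutator K L A B"
  proof clarify
    fix x y assume "x \<in> A'" "y \<in> B'"
    then obtain a b where ab: "a \<in> A" "b \<in> B" "x = p a" "y = p b" using assms(1,2) by blast
    then have "bracket Q x y = p (bracket L a b)" using assms(3,4) by (auto simp: map_bracket subset_iff)
    then show "bracket Q x y \<in> p ` lie_commutator K L A B"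
      using ab L.bracket_mem_commutator by auto
  qed
  then show ?thesis
    unfolding lie_commutator_def[of K Q]
    by (rule Q.span_minimal[OF submodule_image[OF L.submodule_commutator[OF assms(3,4)]]])
qed

text \<open>The map induced by \<open>p\<close> on the n-th exterior powers.\<close>

definition "ext_map n = linear_ext K (exterior_power K Q n) (\<lambda>xs. wedge K Q (map p xs))"

lemma map_tuples: "xs \<in> tuples L n \<Longrightarrow> map p xs \<in> tuples Q n"
  by (auto simp: tuples_def)

lemma
  shows linear_map_ext_map: "linear_map K (exterior_power K L n) (exterior_power K Q n) (ext_map n)"
    and ext_map_wedge: "\<And>xs. xs \<in> tuples L n \<Longrightarrow> ext_map n (wedge K L xs) = wedge K Q (map p xs)"
proof -
  have mul: "multilinear K L (exterior_power K Q n) n (\<lambda>xs. wedge K Q (map p xs))"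
    using Q.multilinear_wedge[of n] map_tuples by (simp add: multilinear_def map_update)
  have alt: "wedge K Q (map p xs) = \<zero>\<^bsub>exterior_power K Q n\<^esub>" if "xs \<in> tuples L n" "\<not> distinct xs" for xs
    using that by (intro Q.wedge_not_distinct map_tuples) (auto simp: distinct_map)
  show "linear_map K (exterior_power K L n) (exterior_power K Q n) (ext_map n)"
    unfolding ext_map_def by (rule L.linear_map_exterior[OF Q.exterior_power_module mul alt])
  show "ext_map n (wedge K L xs) = wedge K Q (map p xs)" if "xs \<in> tuples L n" for xs
    unfolding ext_map_def using L.linear_ext_wedge[OF Q.exterior_power_module mul alt that] .
qed

text \<open>Both composites are linear, so they may be compared on wedges; there the three terms of
  \<open>ce_terms_3\<close> correspond one by one, since \<open>p\<close> respects brackets.\<close>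

lemma ext_map_boundary:
  assumes "z \<in> carrier (exterior_power K L 3)"
  shows "ce_boundary K Q 3 (ext_map 3 z) = ext_map 2 (ce_boundary K L 3 z)"
proof (rule L.linear_map_exterior_eqI[OF linear_map_comp[OF linear_map_ext_map Q.linear_map_boundary_3]
      linear_map_comp[OF L.linear_map_boundary_3 linear_map_ext_map] _ assms])
  interpret e: linear_map K "exterior_power K L 2" "exterior_power K Q 2" "ext_map 2"
    by (rule linear_map_ext_map)
  fix xs assume xs3: "xs \<in> tuples L 3"
  then obtain a b c where xs: "xs = [a, b, c]"
    and L: "a \<in> carrier L" "b \<in> carrier L" "c \<in> carrier L"
    by (elim tuples_3E)
  have w: "ext_map 2 (wedge K L [u, v]) = wedge K Q [p u, p v]" if "u \<in> carrier L" "v \<in> carrier L" for u v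
    using ext_map_wedge[of "[u, v]" 2] that by (simp add: tuples_def)
  have "ce_boundary K Q 3 (ext_map 3 (wedge K L xs)) = Q.ce_terms 3 (map p xs)"
    using xs3 by (simp add: ext_map_wedge Q.ce_boundary_wedge_3 map_tuples)
  also have "\<dots> = ext_map 2 (L.ce_terms 3 xs)"
    using L by (simp add: xs L.ce_terms_3 Q.ce_terms_3 w map_bracket L.multilinear_wedge2(1))
  also have "\<dots> = ext_map 2 (ce_boundary K L 3 (wedge K L xs))"
    using xs3 by (simp add: L.ce_boundary_wedge_3)
  finally show "ce_boundary K Q 3 (ext_map 3 (wedge K L xs)) = ext_map 2 (ce_boundary K L 3 (wedge K L xs))" .
qed

lemma ext_map_cycles:
  assumes "z \<in> ce_cycles K L 3"
  shows "ext_map 3 z \<in> ce_cycles K Q 3"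
proof -
  have "z \<in> carrier (exterior_power K L 3)" "ce_boundary K L 3 z = \<zero>\<^bsub>exterior_power K L 2\<^esub>"
    using assms by (auto simp: ce_cycles_def a_kernel_def')
  then show ?thesis
    using ext_map_boundary linear_map.map_closed[OF linear_map_ext_map]
      linear_map.map_zero[OF linear_map_ext_map, of 2]
    by (simp add: ce_cycles_def a_kernel_def')
qed

end

section \<open>The quotient of a Lie algebra by an ideal\<close>

locale lie_ideal = lie_algebra K L
  for K :: "('k, 'm) ring_scheme" and L :: "('k, 'a, 'n) lie_structure_scheme" (structure)
    and I :: "'a set" +
  assumes submodule_ideal: "submodule I K L"
    and bracket_ideal: "\<lbrakk>x \<in> carrier L; i \<in> I\<rbrakk> \<Longrightarrow> bracket L x i \<in> I"
begin

text \<open>The quotient is realised on a system of coset representatives, so that it lives on the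
  same type as \<open>L\<close>.\<close>

definition rep :: "'a \<Rightarrow> 'a" where "rep x = (SOME y. y \<in> I +>\<^bsub>L\<^esub> x)"

definition quot_lie :: "('k, 'a) lie_structure" where
  "quot_lie = \<lparr>carrier = rep ` carrier L, mult = undefined, one = undefined, zero = rep \<zero>\<^bsub>L\<^esub>,
     add = (\<lambda>x y. rep (x \<oplus>\<^bsub>L\<^esub> y)), smult = (\<lambda>c x. rep (c \<odot>\<^bsub>L\<^esub> x)),
     bracket = (\<lambda>x y. rep (bracket L x y))\<rparr>"

lemma quot_lie_sel:
  "carrier quot_lie = rep ` carrier L" "\<zero>\<^bsub>quot_lie\<^esub> = rep \<zero>\<^bsub>L\<^esub>"
  "x \<oplus>\<^bsub>quot_lie\<^esub> y = rep (x \<oplus>\<^bsub>L\<^esub> y)" "c \<odot>\<^bsub>quot_lie\<^esub> x = rep (c \<odot>\<^bsub>L\<^esub> x)"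
  "bracket quot_lie x y = rep (bracket L x y)"
  by (simp_all add: quot_lie_def)

lemma rep_mem: "x \<in> carrier L \<Longrightarrow> rep x \<in> I +>\<^bsub>L\<^esub> x"
  unfolding rep_def
  by (rule someI[of _ x]) (use submodule_zero_mem[OF submodule_ideal] in \<open>force simp: a_r_coset_def'\<close>)

lemma rep_closed [simp]: "x \<in> carrier L \<Longrightarrow> rep x \<in> carrier L"
  using rep_mem M.a_r_coset_subset_G[OF submoduleE(1)[OF submodule_ideal]] by blast

lemma coset_rep [simp]: "x \<in> carrier L \<Longrightarrow> I +>\<^bsub>L\<^esub> rep x = I +>\<^bsub>L\<^esub> x"
  using M.a_repr_independence[OF rep_mem _ submodule.axioms(1)[OF submodule_ideal]] by simp

text \<open>The choice is made from the coset and not from the element, so \<open>rep\<close> turns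
  congruence modulo \<open>I\<close> into equality. Identities in \<open>quot_lie\<close> are
  obtained from congruences in \<open>L\<close> in this way.\<close>

lemma rep_cong: "I +>\<^bsub>L\<^esub> x = I +>\<^bsub>L\<^esub> y \<Longrightarrow> rep x = rep y"
  by (simp add: rep_def)

text \<open>The arguments are changed one at a time, through [x, y'], by [x, y - y'] and
  [x - x', y']. The locale only gives brackets with the ideal on the right, so the second one is
  turned around by antisymmetry.\<close>

lemma bracket_coset_cong:
  assumes "I +>\<^bsub>L\<^esub> x = I +>\<^bsub>L\<^esub> x'" "I +>\<^bsub>L\<^esub> y = I +>\<^bsub>L\<^esub> y'"
    and L: "x \<in> carrier L" "x' \<in> carrier L" "y \<in> carrier L" "y' \<in> carrier L"
  shows "I +>\<^bsub>L\<^esub> bracket L x y = I +>\<^bsub>L\<^esub> bracket L x' y'"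
proof -
  note I = submoduleE[OF submodule_ideal] and eq = coset_eq_iff[OF submodule_ideal]
  have "x \<ominus>\<^bsub>L\<^esub> x' \<in> I" "y \<ominus>\<^bsub>L\<^esub> y' \<in> I" using assms eq by auto
  then have "bracket L x (y \<ominus>\<^bsub>L\<^esub> y') \<in> I" "bracket L y' (x \<ominus>\<^bsub>L\<^esub> x') \<in> I"
    using bracket_ideal L by auto
  then have "bracket L x (y \<ominus>\<^bsub>L\<^esub> y') \<in> I" "bracket L (x \<ominus>\<^bsub>L\<^esub> x') y' \<in> I"
    using I(3) L by (auto simp: bracket_commute[of y' "x \<ominus>\<^bsub>L\<^esub> x'"])
  moreover have "bracket L x (y \<ominus>\<^bsub>L\<^esub> y') = bracket L x y \<ominus>\<^bsub>L\<^esub> bracket L x y'"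
    "bracket L (x \<ominus>\<^bsub>L\<^esub> x') y' = bracket L x y' \<ominus>\<^bsub>L\<^esub> bracket L x' y'"
    using L by (simp_all add: a_minus_def bracket_add_left bracket_add_right
        bracket_uminus_left bracket_uminus_right)
  ultimately have "I +>\<^bsub>L\<^esub> bracket L x y = I +>\<^bsub>L\<^esub> bracket L x y'"
    "I +>\<^bsub>L\<^esub> bracket L x y' = I +>\<^bsub>L\<^esub> bracket L x' y'"
    using L eq by auto
  then show ?thesis by simp
qed

text \<open>The operations of \<open>quot_lie\<close> act on representatives and then choose anew.
  Choosing before or after an operation makes no difference, which is what transport of structure
  along \<open>rep\<close> asks for.\<close>

lemma
  shows quot_lie_module: "module K quot_lie" and linear_map_rep: "linear_map K L quot_lie rep"
proof -
  interpret q: linear_map K L "quot_module L I" "\<lambda>x. I +>\<^bsub>L\<^esub> x"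
    by (rule linear_map_coset[OF submodule_ideal])
  have add: "rep (rep x \<oplus>\<^bsub>L\<^esub> rep y) = rep (x \<oplus>\<^bsub>L\<^esub> y)"
    if "x \<in> carrier L" "y \<in> carrier L" for x y
    using that by (intro rep_cong) simp
  have smult: "rep (c \<odot>\<^bsub>L\<^esub> rep x) = rep (c \<odot>\<^bsub>L\<^esub> x)"
    if "c \<in> carrier K" "x \<in> carrier L" for c x
    using that by (intro rep_cong) simp
  show "module K quot_lie" "linear_map K L quot_lie rep"
    by (rule module_surjective_image[of quot_lie rep]; simp add: quot_lie_sel add smult)+
qed

lemma rep_bracket:
  "\<lbrakk>x \<in> carrier L; y \<in> carrier L\<rbrakk> \<Longrightarrow> rep (bracket L x y) = bracket quot_lie (rep x) (rep y)"
  by (simp add: quot_lie_sel) (rule rep_cong[OF bracket_coset_cong]; simp)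

sublocale quot: lie_hom K L quot_lie rep
proof -
  interpret r: linear_map K L quot_lie rep by (rule linear_map_rep)
  \<comment> \<open>The homomorphism equations are read backwards: every element of the quotient is
    some \<open>rep x\<close>, so each side of an axiom collects into \<open>rep\<close> of the
    corresponding side in \<open>L\<close>, where the axiom holds.\<close>
  note to_rep = rep_bracket[symmetric] r.map_add[symmetric] r.map_smult[symmetric] r.map_zero[symmetric]
  note [simp del] = r.map_add r.map_smult r.map_zero
  have "lie_algebra_axioms K quot_lie"
    by (rule lie_algebra_axioms.intro; unfold quot_lie_sel(1); elim imageE;
        simp add: to_rep bracket_add_left bracket_add_right bracket_smult_left bracket_smult_right jacobi)
  then have "lie_algebra K quot_lie" by (intro lie_algebra.intro quot_lie_module)
  then show "lie_hom K L quot_lie rep"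
    by (intro lie_hom.intro lie_algebra_axioms linear_map_rep lie_hom_axioms.intro rep_bracket)
qed

text \<open>Three nested commutators in the quotient lie in the image of those in \<open>L\<close>,
  hence in the image of \<open>I\<close>, which is zero.\<close>

lemma quot_lie_three_nilpotent:
  assumes "lie_commutator K L (carrier L)
    (lie_commutator K L (carrier L) (lie_commutator K L (carrier L) (carrier L))) \<subseteq> I"
  shows "three_nilpotent K quot_lie"
proof -
  let ?C = "carrier L" and ?C' = "carrier quot_lie"
  let ?D = "lie_commutator K L ?C ?C"
  have C: "?C' \<subseteq> rep ` ?C" by (simp add: quot_lie_sel(1))
  have D: "?D \<subseteq> ?C" by (simp add: commutator_closed)
  have G: "lie_commutator K L ?C ?D \<subseteq> ?C" by (simp add: commutator_closed D)
  have "lie_commutator K quot_lie ?C' (lie_commutator K quot_lie ?C' (lie_commutator K quot_lie ?C' ?C'))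
      \<subseteq> rep ` lie_commutator K L ?C (lie_commutator K L ?C ?D)"
    by (rule quot.commutator_subset_image[OF C quot.commutator_subset_image[OF C quot.commutator_subset_image[OF C C]]];
        simp add: D G)
  also have "\<dots> \<subseteq> rep ` I" by (rule image_mono[OF assms])
  also have "\<dots> \<subseteq> {\<zero>\<^bsub>quot_lie\<^esub>}"
  proof clarify
    fix i assume "i \<in> I"
    moreover have "i \<in> carrier L" using \<open>i \<in> I\<close> submoduleE(1)[OF submodule_ideal] by blast
    ultimately have "I +>\<^bsub>L\<^esub> i = I +>\<^bsub>L\<^esub> \<zero>\<^bsub>L\<^esub>"
      by (simp add: coset_eq_iff[OF submodule_ideal] M.minus_eq)
    from rep_cong[OF this] show "rep i = \<zero>\<^bsub>quot_lie\<^esub>" by (simp only: quot_lie_sel(2))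
  qed
  finally have sub: "lie_commutator K quot_lie ?C'
      (lie_commutator K quot_lie ?C' (lie_commutator K quot_lie ?C' ?C')) \<subseteq> {\<zero>\<^bsub>quot_lie\<^esub>}" .
  \<comment> \<open>\<open>three_nilpotent\<close> demands equality with the zero submodule, so the
    inclusion has to be completed by membership of zero.\<close>
  have "\<zero>\<^bsub>quot_lie\<^esub> \<in> lie_commutator K quot_lie ?C'
      (lie_commutator K quot_lie ?C' (lie_commutator K quot_lie ?C' ?C'))"
    by (rule quot.Q.submodule_zero_mem, (rule quot.Q.submodule_commutator quot.Q.commutator_closed order_refl)+)
  then show ?thesis unfolding three_nilpotent_def by (intro equalityI[OF sub]) simp
qed

text \<open>If \<open>I\<close> lies in the radical of every invariant form, then \<open>Kill(L)\<close> receives a map from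
  \<open>Kill(L/I)\<close>, through which the Koszul map of \<open>L\<close> factors.\<close>

lemma koszul_map_eq_zero:
  assumes rad: "\<And>i x. \<lbrakk>i \<in> I; x \<in> carrier L\<rbrakk> \<Longrightarrow> kill_prod i x = \<zero>\<^bsub>killing_module K L\<^esub>"
    and z: "z \<in> carrier (exterior_power K L 3)"
    and eq: "koszul_map K quot_lie (quot.ext_map 3 z) = \<zero>\<^bsub>killing_module K quot_lie\<^esub>"
  shows "koszul_map K L z = \<zero>\<^bsub>killing_module K L\<^esub>"
proof -
  let ?Q = quot_lie and ?N = "killing_module K L"
  \<comment> \<open>A representative differs from its element by a member of \<open>I\<close>, which
    the hypothesis places in the radical. So \<open>kill_prod\<close> does not see the choice, and
    it is bilinear for the operations of \<open>quot_lie\<close> as well.\<close>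
  have rep_left: "kill_prod (rep x) y = kill_prod x y" if "x \<in> carrier L" "y \<in> carrier L" for x y
  proof -
    have "rep x \<ominus>\<^bsub>L\<^esub> x \<in> I" using coset_eq_iff[OF submodule_ideal, of "rep x" x] that by simp
    then have "kill_prod (rep x \<ominus>\<^bsub>L\<^esub> x) y = \<zero>\<^bsub>?N\<^esub>" using rad that by simp
    moreover have "rep x = (rep x \<ominus>\<^bsub>L\<^esub> x) \<oplus>\<^bsub>L\<^esub> x"
      using that by (simp add: a_minus_def M.a_assoc M.l_neg)
    ultimately show ?thesis
      using kill_prod_add_left[of "rep x \<ominus>\<^bsub>L\<^esub> x" y x] that by (simp add: kill_prod_closed)
  qed
  have rep_right: "kill_prod x (rep y) = kill_prod x y" if "x \<in> carrier L" "y \<in> carrier L" for x y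
    using rep_left[of y x] that kill_prod_commute[of x] by simp
  have Q: "\<exists>a\<in>carrier L. x = rep a" if "x \<in> carrier ?Q" for x
    using that by (auto simp: quot_lie_sel(1))
  have QL: "x \<in> carrier L" if "x \<in> carrier ?Q" for x using Q[OF that] by auto
  note ops = quot_lie_sel(3-5)
  note [simp del] = quot.map_add quot.map_smult quot.map_zero
  \<comment> \<open>The form on the quotient is \<open>kill_prod\<close> of \<open>L\<close> itself,
    evaluated on representatives; its values lie in the Killing module of \<open>L\<close>.\<close>
  let ?\<phi> = "\<lambda>xs. kill_prod (xs ! 0) (xs ! Suc 0)"
  let ?\<theta> = "linear_ext K ?N ?\<phi>"
  have mul: "multilinear K ?Q ?N 2 ?\<phi>"
    by (rule multilinear_2I; simp add: QL ops rep_left rep_right kill_prod_simps)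
  have sym: "?\<phi> [x, y] = ?\<phi> [y, x]" if "x \<in> carrier ?Q" "y \<in> carrier ?Q" for x y
    using that QL kill_prod_commute by simp
  interpret \<theta>: linear_map K "sym_square K ?Q" ?N ?\<theta>
    by (rule quot.Q.linear_map_sym_square[OF killing_module_module mul sym])
  have \<theta>: "?\<theta> (sym_prod K ?Q x y) = kill_prod x y" if "x \<in> carrier ?Q" "y \<in> carrier ?Q" for x y
    using quot.Q.linear_ext_sym_prod[OF killing_module_module mul sym that] by simp
  \<comment> \<open>On generators this is invariance of \<open>kill_prod\<close>, once
    \<open>rep\<close> has been stripped from the brackets.\<close>
  have "?\<theta> (killing_map K ?Q t) = \<zero>\<^bsub>?N\<^esub>" if "t \<in> carrier (tensor_power K ?Q 3)" for t
  proof (rule quot.Q.linear_map_tensor_eqI[OF linear_map_comp[OF quot.Q.linear_map_killing \<theta>.linear_map_axioms]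
        module.linear_map_zero[OF quot.Q.tensor_power_module killing_module_module] _ that])
    fix xs assume "xs \<in> tuples ?Q 3"
    then obtain a b c where xs: "xs = [a, b, c]"
      and abc: "a \<in> carrier ?Q" "b \<in> carrier ?Q" "c \<in> carrier ?Q"
      by (elim tuples_3E)
    then show "?\<theta> (killing_map K ?Q (presented_gen K (tuples ?Q 3) (multilinear_rels K ?Q 3) xs)) = \<zero>\<^bsub>?N\<^esub>"
      using QL[OF abc(1)] QL[OF abc(2)] QL[OF abc(3)]
      by (simp add: quot.Q.killing_map_gen quot.Q.multilinear_sym \<theta>)
        (simp add: ops rep_left rep_right kill_prod_invariant kill_prod_closed)
  qed
  then have van: "?\<theta> s = \<zero>\<^bsub>?N\<^esub>" if "s \<in> killing_rels K ?Q" for s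
    using that by (auto simp: killing_rels_def)
  let ?\<psi> = "\<lambda>A. the_elem (?\<theta> ` A)"
  have \<psi>: "linear_map K (killing_module K ?Q) ?N ?\<psi>"
    unfolding killing_module_def[of K ?Q]
    by (rule \<theta>.linear_map_factor[OF quot.Q.submodule_killing_rels van])
  have \<psi>_prod: "?\<psi> (quot.Q.kill_prod x y) = kill_prod x y" if "x \<in> carrier ?Q" "y \<in> carrier ?Q" for x y
    using \<theta>.the_elem_coset[OF quot.Q.submodule_killing_rels van] that
    by (simp add: quot.Q.kill_prod_def quot.Q.multilinear_sym \<theta>)
  have "koszul_map K L z = ?\<psi> (koszul_map K ?Q (quot.ext_map 3 z))"
  proof (rule linear_map_exterior_eqI[OF linear_map_koszul linear_map_comp[OF
          linear_map_comp[OF quot.linear_map_ext_map quot.Q.linear_map_koszul] \<psi>] _ z])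
    fix xs assume xs3: "xs \<in> tuples L 3"
    then obtain a b c where xs: "xs = [a, b, c]"
      and L: "a \<in> carrier L" "b \<in> carrier L" "c \<in> carrier L"
      by (elim tuples_3E)
    have "koszul_map K ?Q (quot.ext_map 3 (wedge K L xs))
        = quot.Q.kill_prod (rep a) (bracket ?Q (rep b) (rep c))"
      using xs3 L by (simp add: quot.ext_map_wedge xs quot.Q.koszul_map_wedge)
    also have "?\<psi> \<dots> = kill_prod (rep a) (rep (bracket L b c))"
      using L by (subst \<psi>_prod) (simp_all add: rep_bracket)
    also have "\<dots> = koszul_map K L (wedge K L xs)"
      using L by (simp add: xs koszul_map_wedge rep_left rep_right)
    finally show "koszul_map K L (wedge K L xs) = ?\<psi> (koszul_map K ?Q (quot.ext_map 3 (wedge K L xs)))"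
      by simp
  qed
  then show ?thesis using eq linear_map.map_zero[OF \<psi>] by simp
qed

end

text \<open>The lower central series descends: an element of [g,[g,[g,g]]] lies already in
  [g,[g,g]], so bracketing it with any element of g leads back into [g,[g,[g,g]]].\<close>

lemma (in lie_algebra) lie_ideal_lower_central:
  "lie_ideal K L (lie_commutator K L (carrier L)
    (lie_commutator K L (carrier L) (lie_commutator K L (carrier L) (carrier L))))"
proof -
  let ?C = "carrier L"
  let ?D = "lie_commutator K L ?C ?C"
  let ?G = "lie_commutator K L ?C ?D"
  have D: "?D \<subseteq> ?C" by (simp add: commutator_closed)
  have G: "?G \<subseteq> ?D" by (intro commutator_mono D order_refl)
  have H: "lie_commutator K L ?C ?G \<subseteq> ?G" by (intro commutator_mono D G order_refl)
  show ?thesis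
  proof (intro lie_ideal.intro lie_ideal_axioms.intro lie_algebra_axioms)
    show "submodule (lie_commutator K L ?C ?G) K L" using G D by (intro submodule_commutator) auto
    show "bracket L x i \<in> lie_commutator K L ?C ?G" if "x \<in> ?C" "i \<in> lie_commutator K L ?C ?G" for x i
      using that H by (intro bracket_mem_commutator) auto
  qed
qed

theorem corollary2p11:
  fixes K :: "('k, 'm) ring_scheme"
  assumes "field K"
  shows "(\<forall>L :: ('k, 'a) lie_structure.
            lie_algebra K L \<and> three_nilpotent K L \<longrightarrow> zero_reduced_koszul_map K L)
     \<longleftrightarrow> (\<forall>L :: ('k, 'a) lie_structure.
            lie_algebra K L \<and> metabelian K L \<longrightarrow> zero_reduced_koszul_map K L)"
proof (intro iffI allI impI; elim conjE)
  fix L :: "('k, 'a) lie_structure"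
  assume nil: "\<forall>L :: ('k, 'a) lie_structure.
      lie_algebra K L \<and> three_nilpotent K L \<longrightarrow> zero_reduced_koszul_map K L"
    and "lie_algebra K L" and met: "metabelian K L"
  interpret lie_algebra K L by fact
  let ?I = "lie_commutator K L (carrier L)
    (lie_commutator K L (carrier L) (lie_commutator K L (carrier L) (carrier L)))"
  interpret I: lie_ideal K L ?I by (rule lie_ideal_lower_central)
  \<comment> \<open>The hypothesis speaks of one fixed carrier type, and the quotient on
    representatives has that type.\<close>
  have "zero_reduced_koszul_map K I.quot_lie"
    using nil I.quot.Q.lie_algebra_axioms I.quot_lie_three_nilpotent[OF order_refl] by blast
  then have *: "\<forall>w\<in>ce_cycles K I.quot_lie 3.
      koszul_map K I.quot_lie w = \<zero>\<^bsub>killing_module K I.quot_lie\<^esub>"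
    by (simp only: I.quot.Q.zero_reduced_koszul_map_iff)
  show "zero_reduced_koszul_map K L"
    unfolding zero_reduced_koszul_map_iff
  proof
    fix z assume z: "z \<in> ce_cycles K L 3"
    then have "z \<in> carrier (exterior_power K L 3)" by (simp add: ce_cycles_def a_kernel_def')
    then show "koszul_map K L z = \<zero>\<^bsub>killing_module K L\<^esub>"
      using I.koszul_map_eq_zero[OF kill_prod_metabelian[OF met]] I.quot.ext_map_cycles[OF z] * by blast
  qed
qed (use lie_algebra.three_nilpotent_imp_metabelian in blast)

end
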